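(* Let $\Sigma$ be a signed graph with $n$ vertices and $m$ edges whose underlying graph $G$ is regular of degree $k$. Let the eigenvalues of $\Sigma$ be $\lambda_1,\ldots,\lambda_{b(-\Sigma)}=-k$, $-k<\lambda_{b(-\Sigma)+1},\ldots,\lambda_{n-b(\Sigma)}<k$, and $\lambda_{n-b(\Sigma)+1},\ldots,\lambda_n=k$. The line graph $\Lambda(\Sigma)$ has eigenvalues $\lambda_1-k+2,\ldots,\lambda_{b(-\Sigma)}-k+2=-(2k-2)$, $-(2k-2)<\lambda_{b(-\Sigma)+1}-k+2,\ldots,\lambda_{n-b(\Sigma)}-k+2<2$, and eigenvalue $2$ with multiplicity $m-n+b(\Sigma)$. Its Laplacian eigenvalues are $3k-4-\lambda_1,\ldots,3k-4-\lambda_{b(-\Sigma)}=4k-4$, $4k-4>3k-4-\lambda_{b(-\Sigma)+1},\ldots,3k-4-\lambda_{n-b(\Sigma)}>2k-4$, and $2k-4$ with multiplicity $m-n+b(\Sigma)$. Its energy and Laplacian energy are $$E(\Lambda(\Sigma))=E_L(\Lambda(\Sigma))=\sum_{i=1}^{n-b(\Sigma)}|\lambda_i-(k-2)|+2\big(m-n+b(\Sigma)\big).$$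
   Context: All graphs are finite, simple and loop-free. A signed graph $\Sigma=(G,\sigma)$ is a graph $G=(V,E)$ with a function $\sigma:E\to\{+1,-1\}$; $-\Sigma=(G,-\sigma)$. The sign of a cycle is the product of its edge signs; a signed graph is balanced if every cycle is positive. $b(\Sigma)$ is the number of connected components of $\Sigma$ that are balanced. The adjacency matrix $A(\Sigma)$ has $(u,v)$ entry $\sigma(uv)$ if $u,v$ are adjacent and $0$ otherwise; its eigenvalues are the eigenvalues of $\Sigma$, and the energy $E(\Sigma)$ is the sum of their absolute values. The Laplacian matrix is $L(\Sigma)=D(\Sigma)-A(\Sigma)$, $D(\Sigma)$ being the diagonal matrix of vertex degrees in $G$; its eigenvalues are the Laplacian eigenvalues. The Laplacian energy is $E_L(\Sigma)=\sum_j|\lambda_j(L(\Sigma))-\bar d(\Sigma)|$, where $\lambda_j(L(\Sigma))$ are the eigenvalues of $L(\Sigma)$ and $\bar d(\Sigma)=2|E|/|V|$. Incidence matrix: an $n\times m$ matrix $H(\Sigma)=[\eta_{ik}]$ with $\eta_{ik}=0$ if vertex $v_i$ is not incident with edge $e_k$, $\eta_{ik}=\pm1$ if it is, and $\eta_{ik}\eta_{jk}=-\sigma(v_iv_j)$ for each edge $e_k=v_iv_j$; unique up to multiplying columns by $-1$. Line graph: $\Lambda(\Sigma)$ is the signed graph whose underlying graph is the ordinary line graph of $G$, with signature given by $A(\Lambda(\Sigma))=2I_m-H(\Sigma)^{\mathrm T}H(\Sigma)$ (so every cycle of $\Sigma$ becomes a cycle of the same sign, and any three edges at a common vertex become a negative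 triangle); the choice of $H(\Sigma)$ does not affect eigenvalues or Laplacian eigenvalues. *)

theory Defs
  imports "Jordan_Normal_Form.Char_Poly"
begin

record 'v signed_graph =
  verts :: "'v set"
  edges :: "'v set set"
  sign :: "'v set \<Rightarrow> real"

text \<open>Finite simple signed graphs; an edge is a two-element set of vertices. Only the values of
  the signature on edges are relevant.\<close>

definition signed_graph :: "'v signed_graph \<Rightarrow> bool" where
  "signed_graph S \<longleftrightarrow>
     finite (verts S) \<and>
     (\<forall>e\<in>edges S. e \<subseteq> verts S \<and> card e = 2) \<and>
     (\<forall>e\<in>edges S. sign S e \<in> {1, -1})"

definition negation :: "'v signed_graph \<Rightarrow> 'v signed_graph" where
  "negation S = S\<lparr>sign := (\<lambda>e. - sign S e)\<rparr>"

definition vdegree :: "'v signed_graph \<Rightarrow> 'v \<Rightarrow> nat" where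
  "vdegree S v = card {e \<in> edges S. v \<in> e}"

definition regular :: "'v signed_graph \<Rightarrow> nat \<Rightarrow> bool" where
  "regular S k \<longleftrightarrow> (\<forall>v\<in>verts S. vdegree S v = k)"

subsection \<open>Balance\<close>

text \<open>A cycle is given by the list of its vertices in cyclic order.\<close>

definition is_cycle :: "'v signed_graph \<Rightarrow> 'v list \<Rightarrow> bool" where
  "is_cycle S c \<longleftrightarrow> length c \<ge> 3 \<and> distinct c \<and>
     (\<forall>i<length c. {c ! i, c ! (Suc i mod length c)} \<in> edges S)"

definition cycle_sign :: "'v signed_graph \<Rightarrow> 'v list \<Rightarrow> real" where
  "cycle_sign S c = (\<Prod>i<length c. sign S {c ! i, c ! (Suc i mod length c)})"

definition balanced :: "'v signed_graph \<Rightarrow> bool" where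
  "balanced S \<longleftrightarrow> (\<forall>c. is_cycle S c \<longrightarrow> cycle_sign S c = 1)"

definition adjacency :: "'v signed_graph \<Rightarrow> ('v \<times> 'v) set" where
  "adjacency S = {(u, v). {u, v} \<in> edges S}"

definition induced :: "'v signed_graph \<Rightarrow> 'v set \<Rightarrow> 'v signed_graph" where
  "induced S C = \<lparr>verts = C, edges = {e \<in> edges S. e \<subseteq> C}, sign = sign S\<rparr>"

definition components :: "'v signed_graph \<Rightarrow> 'v signed_graph set" where
  "components S = {induced S ((adjacency S)\<^sup>* `` {v}) |v. v \<in> verts S}"

definition num_balanced :: "'v signed_graph \<Rightarrow> nat" where
  "num_balanced S = card {C \<in> components S. balanced C}"

subsection \<open>Matrices, eigenvalues and energies\<close>

text \<open>Matrices are taken with respect to an enumeration \<open>vs\<close> of the vertices.\<close>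

definition adjacency_mat :: "'v signed_graph \<Rightarrow> 'v list \<Rightarrow> real mat" where
  "adjacency_mat S vs = mat (length vs) (length vs)
     (\<lambda>(i, j). if {vs ! i, vs ! j} \<in> edges S then sign S {vs ! i, vs ! j} else 0)"

definition deg_mat :: "'v signed_graph \<Rightarrow> 'v list \<Rightarrow> real mat" where
  "deg_mat S vs = mat (length vs) (length vs)
     (\<lambda>(i, j). if i = j then real (vdegree S (vs ! i)) else 0)"

definition laplacian_mat :: "'v signed_graph \<Rightarrow> 'v list \<Rightarrow> real mat" where
  "laplacian_mat S vs = deg_mat S vs - adjacency_mat S vs"

text \<open>Eigenvalues with (algebraic) multiplicity. All matrices to which this is applied are real
  symmetric, so that their complex eigenvalues are real.\<close>

definition eigenvals :: "real mat \<Rightarrow> real multiset" where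
  "eigenvals M = proots (char_poly M)"

definition avg_degree :: "'v signed_graph \<Rightarrow> real" where
  "avg_degree S = 2 * real (card (edges S)) / real (card (verts S))"

definition energy :: "'v signed_graph \<Rightarrow> 'v list \<Rightarrow> real" where
  "energy S vs = (\<Sum>x\<in>#eigenvals (adjacency_mat S vs). \<bar>x\<bar>)"

definition laplacian_energy :: "'v signed_graph \<Rightarrow> 'v list \<Rightarrow> real" where
  "laplacian_energy S vs = (\<Sum>x\<in>#eigenvals (laplacian_mat S vs). \<bar>x - avg_degree S\<bar>)"

subsection \<open>Incidence matrices and line graphs\<close>

text \<open>The incidence matrix is first given as a function on vertices and edges.\<close>

definition incidence :: "'v signed_graph \<Rightarrow> ('v \<Rightarrow> 'v set \<Rightarrow> real) \<Rightarrow> bool" where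
  "incidence S \<eta> \<longleftrightarrow>
     (\<forall>v\<in>verts S. \<forall>e\<in>edges S. if v \<in> e then \<eta> v e \<in> {1, -1} else \<eta> v e = 0) \<and>
     (\<forall>u v. u \<noteq> v \<and> {u, v} \<in> edges S \<longrightarrow> \<eta> u {u, v} * \<eta> v {u, v} = - sign S {u, v})"

definition incidence_mat :: "('v \<Rightarrow> 'v set \<Rightarrow> real) \<Rightarrow> 'v list \<Rightarrow> 'v set list \<Rightarrow> real mat" where
  "incidence_mat \<eta> vs es = mat (length vs) (length es) (\<lambda>(i, j). \<eta> (vs ! i) (es ! j))"

text \<open>The vertices of the line graph are the edges of \<open>S\<close>. For \<open>p = {e, f}\<close> the sign below is
  minus the \<open>(e, f)\<close> entry of \<open>H\<^sup>T H\<close>, where \<open>H\<close> is the incidence matrix;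
  see \<open>adjacency_mat_line_graph\<close>.\<close>

definition line_graph ::
    "'v signed_graph \<Rightarrow> ('v \<Rightarrow> 'v set \<Rightarrow> real) \<Rightarrow> 'v set signed_graph" where
  "line_graph S \<eta> =
     \<lparr>verts = edges S,
      edges = {{e, f} |e f. e \<in> edges S \<and> f \<in> edges S \<and> e \<noteq> f \<and> e \<inter> f \<noteq> {}},
      sign = (\<lambda>p. - (\<Sum>v\<in>verts S. \<Prod>e\<in>p. \<eta> v e))\<rparr>"

lemma incidence_exists:
  assumes "signed_graph S"
  shows "\<exists>\<eta>. incidence S \<eta>"
proof -
  define t where "t e = (SOME v. v \<in> e)" for e :: "'a set"
  define \<eta> where
    "\<eta> v e = (if v \<notin> e then 0 else if v = t e then 1 else - sign S e)" for v :: 'a and e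
  have t: "t e \<in> e" if "e \<noteq> {}" for e
    unfolding t_def using that by (simp add: some_in_eq)
  have sg: "sign S e = 1 \<or> sign S e = -1" if "e \<in> edges S" for e
    using assms that unfolding signed_graph_def by blast
  have "\<eta> u {u, v} * \<eta> v {u, v} = - sign S {u, v}" if "u \<noteq> v" for u v
    using that t[of "{u, v}"] by (auto simp: \<eta>_def)
  moreover have "if v \<in> e then \<eta> v e \<in> {1, -1} else \<eta> v e = 0" if "e \<in> edges S" for v e
    using sg[OF that] by (auto simp: \<eta>_def)
  ultimately show ?thesis
    unfolding incidence_def by blast
qed

lemma line_graph_edge_iff:
  "{e, f} \<in> edges (line_graph S \<eta>) \<longleftrightarrow>
     e \<in> edges S \<and> f \<in> edges S \<and> e \<noteq> f \<and> e \<inter> f \<noteq> {}"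
  by (auto simp: line_graph_def doubleton_eq_iff)

lemma sign_line_graph:
  "e \<noteq> f \<Longrightarrow> sign (line_graph S \<eta>) {e, f} = - (\<Sum>v\<in>verts S. \<eta> v e * \<eta> v f)"
  by (simp add: line_graph_def)

lemma incidence_entry:
  assumes "incidence S \<eta>" "v \<in> verts S" "e \<in> edges S"
  shows "if v \<in> e then \<eta> v e = 1 \<or> \<eta> v e = -1 else \<eta> v e = 0"
proof -
  have "if v \<in> e then \<eta> v e \<in> {1, -1} else \<eta> v e = 0"
    using assms unfolding incidence_def by blast
  then show ?thesis by (auto split: if_splits)
qed

lemma signed_graph_line_graph:
  assumes S: "signed_graph S" and H: "incidence S \<eta>"
  shows "signed_graph (line_graph S \<eta>)"
proof -
  have inc: "v \<in> g \<Longrightarrow> \<eta> v g = 1 \<or> \<eta> v g = -1" "v \<notin> g \<Longrightarrow> \<eta> v g = 0"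
    if "v \<in> verts S" "g \<in> edges S" for v g
    using incidence_entry[OF H that] by auto
  have fin: "finite (verts S)" and E: "\<And>e. e \<in> edges S \<Longrightarrow> e \<subseteq> verts S \<and> card e = 2"
    using S unfolding signed_graph_def by auto
  have finE: "finite (edges S)"
    using E fin by (intro finite_subset[of "edges S" "Pow (verts S)"]) auto
  have sgn: "sign (line_graph S \<eta>) {e, f} \<in> {1, -1}"
    if ef: "e \<in> edges S" "f \<in> edges S" "e \<noteq> f" "e \<inter> f \<noteq> {}" for e f
  proof -
    obtain v where v: "v \<in> e" "v \<in> f" using ef by blast
    have uniq: "u = v" if u: "u \<in> e" "u \<in> f" for u
    proof (rule ccontr)
      assume "u \<noteq> v"
      then have c: "card {u, v} = 2" by simp
      have fe: "finite e" "finite f" using E ef by (auto intro: card_ge_0_finite)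
      have "{u, v} = e" using u v fe c E[OF ef(1)] by (intro card_subset_eq) auto
      moreover have "{u, v} = f" using u v fe c E[OF ef(2)] by (intro card_subset_eq) auto
      ultimately show False using ef by simp
    qed
    have vV: "v \<in> verts S" using E ef v by blast
    have z: "\<eta> u e * \<eta> u f = 0" if "u \<in> verts S" "u \<noteq> v" for u
    proof -
      have "u \<notin> e \<or> u \<notin> f" using uniq that by blast
      then show ?thesis using inc(2)[OF that(1)] ef by auto
    qed
    have "(\<Sum>u\<in>verts S. \<eta> u e * \<eta> u f) = \<eta> v e * \<eta> v f"
      by (simp add: sum.remove[OF fin vV] sum.neutral z)
    moreover have "\<eta> v e = 1 \<or> \<eta> v e = -1" "\<eta> v f = 1 \<or> \<eta> v f = -1"
      using inc(1)[OF vV] v ef by simp_all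
    ultimately show ?thesis using sign_line_graph[OF ef(3), of S \<eta>] by auto
  qed
  have "p \<subseteq> edges S \<and> card p = 2 \<and> sign (line_graph S \<eta>) p \<in> {1, -1}"
    if "p \<in> edges (line_graph S \<eta>)" for p
  proof -
    have "\<exists>e f. p = {e, f} \<and> e \<in> edges S \<and> f \<in> edges S \<and> e \<noteq> f \<and> e \<inter> f \<noteq> {}"
      using that by (simp add: line_graph_def)
    then obtain e f where p: "p = {e, f}"
      and ef: "e \<in> edges S" "f \<in> edges S" "e \<noteq> f" "e \<inter> f \<noteq> {}"
      by (elim exE conjE)
    show ?thesis using sgn[OF ef] ef by (simp add: p)
  qed
  moreover have "verts (line_graph S \<eta>) = edges S"
    by (simp add: line_graph_def)
  ultimately show ?thesis
    using finE unfolding signed_graph_def by simp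
qed

lemma adjacency_mat_line_graph:
  assumes S: "signed_graph S" and H: "incidence S \<eta>"
    and vs: "set vs = verts S" "distinct vs" and es: "set es = edges S" "distinct es"
  shows "adjacency_mat (line_graph S \<eta>) es =
           2 \<cdot>\<^sub>m 1\<^sub>m (length es)
             - transpose_mat (incidence_mat \<eta> vs es) * incidence_mat \<eta> vs es"
proof (rule eq_matI)
  fix i j
  assume "i < dim_row (2 \<cdot>\<^sub>m 1\<^sub>m (length es)
             - transpose_mat (incidence_mat \<eta> vs es) * incidence_mat \<eta> vs es)"
    and "j < dim_col (2 \<cdot>\<^sub>m 1\<^sub>m (length es)
             - transpose_mat (incidence_mat \<eta> vs es) * incidence_mat \<eta> vs es)"
  then have ij: "i < length es" "j < length es" by (auto simp: incidence_mat_def)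
  define e f where "e = es ! i" and "f = es ! j"
  have ef: "e \<in> edges S" "f \<in> edges S"
    unfolding e_def f_def es(1)[symmetric] using ij by simp_all
  have eq: "e = f \<longleftrightarrow> i = j"
    unfolding e_def f_def using nth_eq_iff_index_eq[OF es(2) ij] .
  have inc: "v \<in> g \<Longrightarrow> \<eta> v g = 1 \<or> \<eta> v g = -1" "v \<notin> g \<Longrightarrow> \<eta> v g = 0"
    if "v \<in> verts S" "g \<in> edges S" for v g
    using incidence_entry[OF H that] by auto
  have fin: "finite (verts S)" and E: "e \<subseteq> verts S" "card e = 2"
    using S ef unfolding signed_graph_def by auto
  have "(\<Sum>a<length vs. \<eta> (vs ! a) e * \<eta> (vs ! a) f) = (\<Sum>v\<in>verts S. \<eta> v e * \<eta> v f)"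
    using sum.reindex_bij_betw[OF bij_betw_nth[OF vs(2) refl vs(1)[symmetric]]] .
  then have R: "(2 \<cdot>\<^sub>m 1\<^sub>m (length es)
       - transpose_mat (incidence_mat \<eta> vs es) * incidence_mat \<eta> vs es) $$ (i, j) =
       (if i = j then 2 else 0) - (\<Sum>v\<in>verts S. \<eta> v e * \<eta> v f)"
    using ij by (simp add: incidence_mat_def scalar_prod_def e_def f_def lessThan_atLeast0)
  have "adjacency_mat (line_graph S \<eta>) es $$ (i, j) =
       (if {e, f} \<in> edges (line_graph S \<eta>) then sign (line_graph S \<eta>) {e, f} else 0)"
    using ij by (simp add: adjacency_mat_def e_def f_def)
  also have "\<dots> = (if i = j then 2 else 0) - (\<Sum>v\<in>verts S. \<eta> v e * \<eta> v f)"
  proof (cases "i = j")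
    case True
    have "(\<Sum>v\<in>verts S. \<eta> v e * \<eta> v e) = (\<Sum>v\<in>verts S. if v \<in> e then 1 else 0)"
    proof (rule sum.cong[OF refl])
      fix v assume "v \<in> verts S"
      then show "\<eta> v e * \<eta> v e = (if v \<in> e then 1 else 0)"
        using incidence_entry[OF H _ ef(1), of v] by (auto split: if_splits)
    qed
    also have "\<dots> = real (card e)"
      using fin E by (simp add: sum.If_cases Int_absorb1)
    finally show ?thesis
      using True eq E line_graph_edge_iff[of e f S \<eta>] by simp
  next
    case False
    show ?thesis
    proof (cases "e \<inter> f = {}")
      case True
      have "(\<Sum>v\<in>verts S. \<eta> v e * \<eta> v f) = 0"
      proof (rule sum.neutral, rule ballI)
        fix v assume v: "v \<in> verts S"
        from True have "v \<notin> e \<or> v \<notin> f" by blast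
        then show "\<eta> v e * \<eta> v f = 0" using inc(2)[OF v] ef by auto
      qed
      then show ?thesis using False True by (simp add: line_graph_edge_iff)
    next
      case nonempty: False
      then show ?thesis
        using False eq ef by (simp add: line_graph_edge_iff sign_line_graph)
    qed
  qed
  finally show "adjacency_mat (line_graph S \<eta>) es $$ (i, j) =
     (2 \<cdot>\<^sub>m 1\<^sub>m (length es)
       - transpose_mat (incidence_mat \<eta> vs es) * incidence_mat \<eta> vs es) $$ (i, j)"
    using R by simp
qed (auto simp: adjacency_mat_def incidence_mat_def)

end

theory Submission
  imports Defs
    "Jordan_Normal_Form.Jordan_Normal_Form_Existence"
    "Jordan_Normal_Form.Jordan_Normal_Form_Uniqueness"
begin

text \<open>With \<open>A\<close> the adjacency matrix and \<open>H\<close> an incidence matrix of \<open>S\<close>, regularity gives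
  \<open>H H\<^sup>T = k I - A\<close>, while the line graph has adjacency matrix \<open>2 I - H\<^sup>T H\<close> and is regular of
  degree \<open>2 k - 2\<close>. The two Gram matrices have the same spectrum up to the multiplicity of \<open>0\<close>,
  and they are positive semidefinite, so \<open>A\<close> has no eigenvalue above \<open>k\<close>. The multiplicity of \<open>k\<close> is
  the dimension of \<open>{x. H\<^sup>T x = 0}\<close>, that is, of the space of functions with \<open>x v = \<sigma>(uv) x u\<close> on
  every edge. Such a function vanishes on unbalanced components, and on a balanced component it is
  a multiple of a switching function \<open>\<theta>\<close> with values \<open>1\<close> and \<open>-1\<close> and \<open>\<sigma>(uv) = \<theta> u \<theta> v\<close>. So the
  multiplicity of \<open>k\<close> is the number of balanced components, and the multiplicity of \<open>-k\<close> follows by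
  passing to the negated graph.\<close>

subsection \<open>Spectra of symmetric matrices\<close>

lemma poly_char_poly:
  fixes A :: "'a :: field mat"
  assumes "A \<in> carrier_mat n n"
  shows "poly (char_poly A) x = det (x \<cdot>\<^sub>m 1\<^sub>m n - A)"
proof -
  have "x \<cdot>\<^sub>m 1\<^sub>m n - A = - char_matrix A x"
    using assms by (intro eq_matI) (auto simp: char_matrix_def)
  then show ?thesis
    using char_poly_matrix[OF assms, of x] by (simp add: char_poly_def)
qed

text \<open>\<open>eigenvals\<close> collects only real roots, so \<open>size R = n\<close>
  expresses that the characteristic polynomial splits over the reals. Dividing out all roots leaves
  a factor of degree 0, and monicity makes it 1.\<close>

lemma eigenvals_imp_char_poly:
  assumes A: "A \<in> carrier_mat n n" and "eigenvals A = R" "size R = n"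
  shows "char_poly A = (\<Prod>a\<in>#R. [:- a, 1:])"
proof -
  have *: "\<exists>q. p = (\<Prod>a\<in>#proots p. [:- a, 1:]) * q \<and> degree p = size (proots p) + degree q"
    if "p \<noteq> 0" for p :: "real poly"
    using that
  proof (induction "degree p" arbitrary: p rule: less_induct)
    case less
    show ?case
    proof (cases "\<exists>a. poly p a = 0")
      case False
      then have "set_mset (proots p) = {}" using less.prems by simp
      then show ?thesis by simp
    next
      case True
      then obtain a r where r: "p = [:- a, 1:] * r"
        by (metis poly_eq_0_iff_dvd dvdE)
      with less.prems have r0: "r \<noteq> 0" by auto
      have d: "degree p = Suc (degree r)" using r0 unfolding r by (subst degree_mult_eq) auto
      obtain q where "r = (\<Prod>a\<in>#proots r. [:- a, 1:]) * q"
        "degree r = size (proots r) + degree q"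
        using less.hyps[OF _ r0] d by auto
      moreover have "proots p = add_mset a (proots r)"
        unfolding r using r0 by (subst proots_mult) auto
      ultimately show ?thesis
        using d r by (metis (no_types, lifting) add_Suc image_mset_add_mset mult.assoc
            prod_mset.add_mset size_add_mset)
    qed
  qed
  have m: "degree (char_poly A) = n" "lead_coeff (char_poly A) = 1"
    using degree_monic_char_poly[OF A] by auto
  then have "char_poly A \<noteq> 0" by auto
  from *[OF this] obtain q where
    q: "char_poly A = (\<Prod>a\<in>#R. [:- a, 1:]) * q" "degree q = 0"
    using assms(2,3) m by (auto simp: eigenvals_def)
  from q(2) obtain c where c: "q = [:c:]" by (rule degree_eq_zeroE)
  have "lead_coeff (\<Prod>a\<in>#R. [:- a, 1:]) = 1"
    by (induction R) (auto simp: lead_coeff_mult simp del: mult_pCons_left)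
  then have "c = 1" using m(2) unfolding q(1) c by (simp add: lead_coeff_mult split: if_splits)
  then show ?thesis using q c by simp
qed

lemma char_poly_imp_eigenvals:
  assumes "char_poly A = (\<Prod>a\<in>#R. [:- a, 1:])"
  shows "eigenvals A = R"
proof -
  have "proots (\<Prod>a\<in>#R. [:- a, 1:]) = R"
  proof (induction R)
    case (add a R)
    have "(\<Prod>a\<in>#R. [:- a, 1:]) \<noteq> 0" by (auto simp: prod_mset_zero_iff)
    then have "proots ([:- a, 1:] * (\<Prod>a\<in>#R. [:- a, 1:])) = add_mset a R"
      using add by (subst proots_mult) auto
    then show ?case by (simp del: mult_pCons_left)
  qed simp
  then show ?thesis using assms by (simp add: eigenvals_def)
qed

text \<open>Passing from \<open>A\<close> to \<open>d I - A\<close> substitutes \<open>d - x\<close>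
  for \<open>x\<close> in the characteristic polynomial, up to the sign \<open>(-1) ^ n\<close>.
  This serves four passages: to \<open>k I - A\<close>, from a Gram matrix to the line graph, from
  there to its Laplacian, and, with \<open>d = 0\<close>, to the negated graph.\<close>

lemma eigenvals_scalar_minus:
  assumes A: "A \<in> carrier_mat n n" and R: "eigenvals A = R" "size R = n"
  shows "eigenvals (d \<cdot>\<^sub>m 1\<^sub>m n - A) = {#d - a. a \<in># R#}"
proof (rule char_poly_imp_eigenvals, rule poly_ext)
  fix x
  have *: "x \<cdot>\<^sub>m 1\<^sub>m n - (d \<cdot>\<^sub>m 1\<^sub>m n - A) = (-1) \<cdot>\<^sub>m ((d - x) \<cdot>\<^sub>m 1\<^sub>m n - A)"
    using A by (intro eq_matI) auto
  have "poly (char_poly (d \<cdot>\<^sub>m 1\<^sub>m n - A)) x = (-1) ^ size R * poly (char_poly A) (d - x)"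
    using A R by (simp add: poly_char_poly[of _ n] minus_carrier_mat *)
  also have "\<dots> = poly (\<Prod>a\<in>#{#d - a. a \<in># R#}. [:- a, 1:]) x"
    unfolding eigenvals_imp_char_poly[OF A R]
    by (induction R) (auto simp: algebra_simps)
  finally show "poly (char_poly (d \<cdot>\<^sub>m 1\<^sub>m n - A)) x
      = poly (\<Prod>a\<in>#{#d - a. a \<in># R#}. [:- a, 1:]) x" .
qed

text \<open>Sylvester's determinant identity. The powers of the variable balance the different sizes
  of the two products, giving one polynomial identity for \<open>n \<le> m\<close> and
  \<open>m \<le> n\<close> alike.\<close>

lemma char_poly_mult_commute:
  fixes A B :: "real mat"
  assumes A: "A \<in> carrier_mat n m" and B: "B \<in> carrier_mat m n"
  shows "monom 1 m * char_poly (A * B) = monom 1 n * char_poly (B * A)"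
proof (rule poly_ext)
  fix x :: real
  txt \<open>The determinant of \<open>P\<close> is computed by eliminating the lower left block, once from the right
    and once from the left.\<close>
  define P where "P = four_block_mat (x \<cdot>\<^sub>m 1\<^sub>m n) A B (1\<^sub>m m)"
  define Q where "Q = four_block_mat (1\<^sub>m n) (0\<^sub>m n m) (- B) (1\<^sub>m m)"
  define R where "R = four_block_mat (1\<^sub>m n) (0\<^sub>m n m) (- B) (x \<cdot>\<^sub>m 1\<^sub>m m)"
  have c: "P \<in> carrier_mat (n + m) (n + m)" "Q \<in> carrier_mat (n + m) (n + m)"
    "R \<in> carrier_mat (n + m) (n + m)"
    using A B by (auto simp: P_def Q_def R_def)
  have "P * Q = four_block_mat (x \<cdot>\<^sub>m 1\<^sub>m n - A * B) A (0\<^sub>m m n) (1\<^sub>m m)"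
    unfolding P_def Q_def using A B
    by (subst mult_four_block_mat[of _ n n _ m _ m _ _ n _ m])
      (auto intro!: arg_cong4[of _ _ _ _ _ _ _ _ four_block_mat] eq_matI)
  then have 1: "det P * det Q = det (x \<cdot>\<^sub>m 1\<^sub>m n - A * B)"
    using A B by (simp add: det_mult[OF c(1,2), symmetric] det_four_block_mat_lower_left_zero[of _ n _ m]
        minus_carrier_mat)
  have "R * P = four_block_mat (x \<cdot>\<^sub>m 1\<^sub>m n) A (0\<^sub>m m n) (x \<cdot>\<^sub>m 1\<^sub>m m - B * A)"
    unfolding P_def R_def using A B
    by (subst mult_four_block_mat[of _ n n _ m _ m _ _ n _ m])
      (auto intro!: arg_cong4[of _ _ _ _ _ _ _ _ four_block_mat] eq_matI)
  then have 2: "det R * det P = x ^ n * det (x \<cdot>\<^sub>m 1\<^sub>m m - B * A)"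
    using A B by (simp add: det_mult[OF c(3,1), symmetric] det_four_block_mat_lower_left_zero[of _ n _ m]
        minus_carrier_mat)
  have "det Q = 1" "det R = x ^ m"
    unfolding Q_def R_def using A B
    by (simp_all add: det_four_block_mat_upper_right_zero[of _ n _ m])
  then show "poly (monom 1 m * char_poly (A * B)) x = poly (monom 1 n * char_poly (B * A)) x"
    using 1 2 A B by (simp add: poly_monom poly_char_poly[of _ n] poly_char_poly[of _ m])
qed

lemma scalar_prod_self_nonneg: "0 \<le> (v :: real vec) \<bullet> v"
  by (simp add: scalar_prod_def sum_nonneg)

lemma scalar_prod_self_eq_0:
  fixes v :: "real vec"
  assumes "v \<bullet> v = 0" "v \<in> carrier_vec n"
  shows "v = 0\<^sub>v n"
  using assms by (intro eq_vecI) (auto simp: scalar_prod_def sum_nonneg_eq_0_iff)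

text \<open>This carries the positive semidefiniteness of \<open>H * transpose_mat H\<close>; it
  also shows that this product and \<open>transpose_mat H\<close> have the same kernel.\<close>

lemma scalar_prod_gram:
  fixes H :: "real mat"
  assumes H: "H \<in> carrier_mat n m" and x: "x \<in> carrier_vec n"
  shows "x \<bullet> (H * transpose_mat H *\<^sub>v x) = (transpose_mat H *\<^sub>v x) \<bullet> (transpose_mat H *\<^sub>v x)"
proof -
  have "H * transpose_mat H *\<^sub>v x = H *\<^sub>v (transpose_mat H *\<^sub>v x)"
    using assoc_mult_mat_vec[OF H _ x, of "transpose_mat H"] H by simp
  then show ?thesis
    using transpose_vec_mult_scalar[OF H, of "transpose_mat H *\<^sub>v x" x] H x by simp
qed

text \<open>Symmetry moves one factor across the scalar product, so a vector killed by
  \<open>M * M\<close> has an image under \<open>M\<close> of length zero.\<close>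

lemma mat_kernel_square_symmetric:
  fixes M :: "real mat"
  assumes M: "M \<in> carrier_mat n n" and sym: "transpose_mat M = M"
  shows "mat_kernel (M * M) = mat_kernel M"
proof
  show "mat_kernel M \<subseteq> mat_kernel (M * M)"
    by (rule mat_kernel_mult_subset[OF M M])
  show "mat_kernel (M * M) \<subseteq> mat_kernel M"
  proof
    fix v assume "v \<in> mat_kernel (M * M)"
    then have v: "v \<in> carrier_vec n" and z: "M * M *\<^sub>v v = 0\<^sub>v n"
      using mat_kernelD[of "M * M" n n v] M by auto
    have "(M *\<^sub>v v) \<bullet> (M *\<^sub>v v) = (transpose_mat M *\<^sub>v v) \<bullet> (M *\<^sub>v v)"
      by (simp add: sym)
    also have "\<dots> = v \<bullet> (M *\<^sub>v (M *\<^sub>v v))"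
      using transpose_vec_mult_scalar[OF M, of "M *\<^sub>v v" v] M v by simp
    also have "\<dots> = 0" using z M v assoc_mult_mat_vec[OF M M v] by simp
    finally have "M *\<^sub>v v = 0\<^sub>v n"
      using M v by (intro scalar_prod_self_eq_0) auto
    then show "v \<in> mat_kernel M" using mat_kernelI[OF M v] by simp
  qed
qed

text \<open>Since \<open>M\<close> and \<open>M\<^sup>2\<close> have the same kernel, all Jordan blocks have size \<open>1\<close>.\<close>

lemma order_char_poly_symmetric:
  fixes A :: "real mat"
  assumes A: "A \<in> carrier_mat n n" and sym: "transpose_mat A = A"
    and split: "char_poly A = (\<Prod>a\<leftarrow>as. [:- a, 1:])"
  shows "Polynomial.order a (char_poly A) = kernel_dim (char_matrix A a)"
proof -
  obtain bs where jnf: "jordan_nf A bs"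
    using jordan_nf_exists[OF A split] by blast
  let ?M = "char_matrix A a" and ?ns = "map fst (filter (\<lambda>(n, e). e = a) bs)"
  have M: "?M \<in> carrier_mat n n" using A by simp
  have symM: "transpose_mat ?M = ?M"
  proof (rule eq_matI)
    fix i j assume ij: "i < dim_row ?M" "j < dim_col ?M"
    have "transpose_mat A $$ (i, j) = A $$ (i, j)" by (simp only: sym)
    then show "transpose_mat ?M $$ (i, j) = ?M $$ (i, j)"
      using ij A by (auto simp: char_matrix_def)
  qed (use M in auto)
  have "dim_gen_eigenspace A a 2 = dim_gen_eigenspace A a 1"
  proof -
    have "?M ^\<^sub>m 1 = ?M" "?M ^\<^sub>m 2 = ?M * ?M"
      using M by (simp_all add: numeral_2_eq_2)
    then show ?thesis
      unfolding dim_gen_eigenspace_def kernel_dim_def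
      using mat_kernel_square_symmetric[OF M symM] M by simp
  qed
  \<comment> \<open>The kernel of the \<open>j\<close>-th power of \<open>?M\<close> has dimension
    the sum of \<open>min j n\<close> over the sizes \<open>n\<close> of the Jordan blocks for
    \<open>a\<close>.\<close>
  then have eq: "(\<Sum>n\<leftarrow>?ns. min 2 n) = (\<Sum>n\<leftarrow>?ns. min 1 n)"
    by (simp only: dim_gen_eigenspace[OF jnf])
  \<comment> \<open>Since \<open>min 1 n \<le> min 2 n\<close> in every term, equal sums force equal
    terms, which leaves only block sizes up to 1.\<close>
  have "sum_list ns = (\<Sum>n\<leftarrow>ns. min 1 n)"
    if "(\<Sum>n\<leftarrow>ns. min 2 n) = (\<Sum>n\<leftarrow>ns. min 1 n)" for ns :: "nat list"
    using that
  proof (induction ns)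
    case (Cons n ns)
    have "(\<Sum>n\<leftarrow>ns. min 1 n) \<le> (\<Sum>n\<leftarrow>ns. min 2 n)"
      by (rule sum_list_mono) simp
    moreover have "min 1 n \<le> min 2 n" by simp
    ultimately have "min 2 n = min 1 n" and eq: "(\<Sum>n\<leftarrow>ns. min 2 n) = (\<Sum>n\<leftarrow>ns. min 1 n)"
      using Cons.prems unfolding list.map sum_list.Cons by linarith+
    then have "n = min 1 n" by linarith
    then show ?case unfolding list.map sum_list.Cons using Cons.IH[OF eq] by linarith
  qed simp
  from this[OF eq] have "sum_list ?ns = dim_gen_eigenspace A a 1"
    by (simp only: dim_gen_eigenspace[OF jnf])
  also have "\<dots> = kernel_dim ?M" using M by (simp add: dim_gen_eigenspace_def)
  finally show ?thesis
    by (simp add: jordan_nf_order[OF jnf] case_prod_unfold)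
qed

text \<open>A full supply of real eigenvalues splits the characteristic polynomial, so a Jordan form
  exists and multiplicities become dimensions of kernels.\<close>

lemma count_eigenvals_symmetric:
  assumes A: "A \<in> carrier_mat n n" and sym: "transpose_mat A = A"
    and R: "eigenvals A = R" "size R = n"
  shows "count R a = kernel_dim (char_matrix A a)"
proof -
  obtain as where as: "mset as = R" using ex_mset by blast
  have c: "char_poly A = (\<Prod>a\<leftarrow>as. [:- a, 1:])"
    unfolding eigenvals_imp_char_poly[OF A R] as[symmetric]
    by (simp flip: mset_map add: prod_mset_prod_list)
  have "char_poly A \<noteq> 0" using degree_monic_char_poly[OF A] by auto
  then show ?thesis
    using order_char_poly_symmetric[OF A sym c, of a] unfolding R(1)[symmetric] eigenvals_def
    by (subst count_proots)
qed

text \<open>Up to powers of the variable both products have the same characteristic polynomial.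
  Hence their nonzero roots agree, and comparing the multiplicities of \<open>0\<close> shows that
  the subtraction \<open>m + b - n\<close> is exact.\<close>

lemma eigenvals_mult_transpose:
  assumes H: "H \<in> carrier_mat n m"
    and R: "eigenvals (H * transpose_mat H) = R + replicate_mset b 0" "size R + b = n" "0 \<notin># R"
  shows "n \<le> m + b"
    and "eigenvals (transpose_mat H * H) = R + replicate_mset (m + b - n) 0"
    and "size R + (m + b - n) = m"
proof -
  let ?p = "char_poly (H * transpose_mat H)" and ?q = "char_poly (transpose_mat H * H)"
  have c: "H * transpose_mat H \<in> carrier_mat n n" "transpose_mat H * H \<in> carrier_mat m m"
    using H by auto
  have nz: "?p \<noteq> 0" "?q \<noteq> 0"
    using degree_monic_char_poly[OF c(1)] degree_monic_char_poly[OF c(2)] by auto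
  have X: "proots (monom (1::real) d) = replicate_mset d 0" for d
    by (simp add: monom_altdef proots_power)
  have "proots (monom 1 m * ?p) = proots (monom 1 n * ?q)"
    using char_poly_mult_commute[OF H, of "transpose_mat H"] H by simp
  then have eq: "replicate_mset m 0 + (R + replicate_mset b 0)
      = replicate_mset n 0 + eigenvals (transpose_mat H * H)"
    using nz R(1) by (simp add: proots_mult X eigenvals_def)
  have "count R 0 = 0" using R(3) by (simp add: count_eq_zero_iff)
  then show le: "n \<le> m + b" using arg_cong[OF eq, of "\<lambda>M. count M 0"] by simp
  show "eigenvals (transpose_mat H * H) = R + replicate_mset (m + b - n) 0"
  proof (rule multiset_eqI)
    fix x show "count (eigenvals (transpose_mat H * H)) x
        = count (R + replicate_mset (m + b - n) 0) x"
      using arg_cong[OF eq, of "\<lambda>M. count M x"] le by (cases "x = 0") auto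
  qed
  show "size R + (m + b - n) = m" using R(2) le by simp
qed

subsection \<open>Balance and switching\<close>

fun walk_sign :: "('v set \<Rightarrow> real) \<Rightarrow> 'v list \<Rightarrow> real" where
  "walk_sign s (u # v # w) = s {u, v} * walk_sign s (v # w)"
| "walk_sign s w = 1"

abbreviation walk :: "'v signed_graph \<Rightarrow> 'v list \<Rightarrow> bool" where
  "walk S \<equiv> successively (\<lambda>u v. {u, v} \<in> edges S)"

lemma walk_sign_append:
  "xs \<noteq> [] \<Longrightarrow> ys \<noteq> [] \<Longrightarrow>
   walk_sign s (xs @ ys) = walk_sign s xs * s {last xs, hd ys} * walk_sign s ys"
  by (induction s xs rule: walk_sign.induct) (auto simp: neq_Nil_conv)

lemma walk_sign_rev: "walk_sign s (rev w) = walk_sign s w"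
proof (induction s w rule: walk_sign.induct)
  case (1 s u v w)
  then show ?case
    using walk_sign_append[of "rev w @ [v]" "[u]" s] by (simp add: insert_commute)
qed simp_all

lemma walk_sign_nth: "walk_sign s w = (\<Prod>i<length w - 1. s {w ! i, w ! Suc i})"
  by (induction s w rule: walk_sign.induct)
    (simp_all add: prod.lessThan_Suc_shift del: prod.lessThan_Suc)

lemma edge_neq:
  assumes "signed_graph S" "{u, v} \<in> edges S"
  shows "u \<noteq> v"
  using assms unfolding signed_graph_def by fastforce

lemma sign_edge:
  assumes "signed_graph S" "e \<in> edges S"
  shows "sign S e = 1 \<or> sign S e = -1"
  using assms unfolding signed_graph_def by blast

lemma walk_sign_cases:
  "signed_graph S \<Longrightarrow> walk S w \<Longrightarrow> walk_sign (sign S) w = 1 \<or> walk_sign (sign S) w = -1"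
  by (induction "sign S" w rule: walk_sign.induct) (auto dest: sign_edge)

text \<open>Repeating the last vertex in front turns the cyclic list into a closed walk whose first
  edge is the wrap-around edge.\<close>

lemma cycle_sign_walk:
  assumes "w \<noteq> []"
  shows "cycle_sign S w = walk_sign (sign S) (last w # w)"
proof -
  obtain n where n: "length w = Suc n" using assms by (cases w) auto
  have "cycle_sign S w = (\<Prod>i<n. sign S {w ! i, w ! Suc i}) * sign S {w ! n, w ! 0}"
    unfolding cycle_sign_def n by (simp add: mult.commute)
  then show ?thesis
    using walk_sign_append[of "[last w]" w "sign S"] assms n
    by (simp add: walk_sign_nth last_conv_nth hd_conv_nth mult.commute)
qed

lemma is_cycle_walk:
  assumes "length w \<ge> 3" "distinct w" "walk S (last w # w)"
  shows "is_cycle S w"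
  unfolding is_cycle_def
proof (intro conjI allI impI)
  fix i assume i: "i < length w"
  have w: "w \<noteq> []" using assms by auto
  show "{w ! i, w ! (Suc i mod length w)} \<in> edges S"
  proof (cases "Suc i < length w")
    case True
    then show ?thesis using assms(3) successively_nth[of _ "last w # w" "Suc i"] by auto
  next
    case False
    then have "Suc i = length w" using i by simp
    then have "{w ! i, w ! (Suc i mod length w)} = {last w, hd w}"
      using w by (simp add: last_conv_nth hd_conv_nth flip: \<open>Suc i = length w\<close>)
    then show ?thesis using assms(3) w by (simp add: successively_Cons)
  qed
qed (use assms in auto)

text \<open>A closed walk that is neither a cycle nor of the form \<open>v u v\<close> is cut at a repeated vertex into
  two shorter closed walks.\<close>

lemma balanced_closed_walk:
  assumes S: "signed_graph S" and bal: "balanced S"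
  shows "w \<noteq> [] \<Longrightarrow> walk S w \<Longrightarrow> hd w = last w \<Longrightarrow> walk_sign (sign S) w = 1"
proof (induction "length w" arbitrary: w rule: less_induct)
  case less
  then obtain v w' where w: "w = v # w'" by (cases w) auto
  show ?case
  proof (cases "distinct w'")
    case True
    \<comment> \<open>\<open>w'\<close> is the closed walk without its first vertex. Lengths 0, 1
      and 2 are a single vertex, an impossible loop and an edge traversed twice; from length 3 on,
      \<open>w'\<close> is a genuine cycle.\<close>
    consider "w' = []" | a where "w' = [a]" | a b where "w' = [a, b]"
      | a b c ys where "w' = a # b # c # ys"
      by (metis list.exhaust)
    then show ?thesis
    proof cases
      case (2 a)
      then show ?thesis using less.prems w edge_neq[OF S] by force
    next
      case (3 a b)
      then show ?thesis using less.prems w sign_edge[OF S, of "{a, b}"]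
        by (auto simp: insert_commute)
    next
      case 4
      then have len: "length w' \<ge> 3" and "w' \<noteq> []" by auto
      then have "v = last w'" using less.prems w by simp
      then show ?thesis
        using bal is_cycle_walk[OF len True, of S] cycle_sign_walk[OF \<open>w' \<noteq> []\<close>, of S] less.prems w
        by (simp add: balanced_def)
    qed (use w in simp)
  next
    case False
    then obtain xs y ys zs where d: "w' = xs @ [y] @ ys @ [y] @ zs"
      using not_distinct_decomp by blast
    \<comment> \<open>The part between the two occurrences of \<open>y\<close> is a closed walk, and
      bypassing it leaves a closed walk at \<open>v\<close>. Both are shorter than \<open>w\<close>,
      and their signs multiply to that of \<open>w\<close>.\<close>
    have "walk S ([v] @ xs @ [y] @ ys @ [y] @ zs)" using less.prems w d by simp
    then have "walk S ([y] @ ys @ [y])"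
      unfolding successively_append_iff by (cases ys) simp_all
    then have "walk_sign (sign S) ([y] @ ys @ [y]) = 1"
      using w d by (intro less.hyps) auto
    moreover have "walk S ([v] @ xs @ [y] @ zs)"
      using \<open>walk S ([v] @ _)\<close> unfolding successively_append_iff by (cases xs) simp_all
    then have "walk_sign (sign S) (v # xs @ [y] @ zs) = 1"
      using less.prems w d by (intro less.hyps) auto
    moreover have "walk_sign (sign S) w = walk_sign (sign S) (v # xs @ [y] @ zs) * walk_sign (sign S) ([y] @ ys @ [y])"
      unfolding w d using walk_sign_append[of "v # xs" "y # ys @ [y] @ zs" "sign S"]
        walk_sign_append[of "v # xs" "y # zs" "sign S"]
        walk_sign_append[of "y # ys" "y # zs" "sign S"] walk_sign_append[of "y # ys" "[y]" "sign S"]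
      by simp
    ultimately show ?thesis by simp
  qed
qed

text \<open>Each inner vertex contributes its value of \<open>\<theta>\<close> twice, so only the
  two ends survive.\<close>

lemma walk_sign_switching:
  assumes "\<And>u v. {u, v} \<in> edges S \<Longrightarrow> sign S {u, v} = \<theta> u * \<theta> v"
    and "\<And>u. \<theta> u * \<theta> u = (1::real)"
  shows "w \<noteq> [] \<Longrightarrow> walk S w \<Longrightarrow> walk_sign (sign S) w = \<theta> (hd w) * \<theta> (last w)"
proof (induction "sign S" w rule: walk_sign.induct)
  case (1 u v w)
  have "walk_sign (sign S) (u # v # w) = \<theta> u * (\<theta> v * \<theta> v) * \<theta> (last (v # w))"
    using 1 assms(1)[of u v] by simp
  then show ?case by (simp add: assms(2))
qed (simp_all add: assms(2))

lemma cycle_walk: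
  assumes "is_cycle S w"
  shows "w \<noteq> []" "walk S (last w # w)"
proof -
  have c: "length w \<ge> 3" "\<And>i. i < length w \<Longrightarrow> {w ! i, w ! (Suc i mod length w)} \<in> edges S"
    using assms by (auto simp: is_cycle_def)
  show w: "w \<noteq> []" using c by auto
  have "walk S w"
    unfolding successively_conv_nth
  proof (intro allI impI)
    fix i assume "Suc i < length w"
    then show "{w ! i, w ! Suc i} \<in> edges S" using c(2)[of i] by simp
  qed
  moreover have "{last w, hd w} \<in> edges S"
    using c(2)[of "length w - 1"] w by (simp add: last_conv_nth hd_conv_nth)
  ultimately show "walk S (last w # w)" using w by (simp add: successively_Cons)
qed

text \<open>The easy half of Harary's criterion: the ends of a closed walk agree, and
  \<open>\<theta>\<close> squares to 1.\<close>

lemma balanced_if_switching: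
  assumes "\<And>u v. {u, v} \<in> edges S \<Longrightarrow> sign S {u, v} = \<theta> u * \<theta> v"
    and "\<And>u. \<theta> u * \<theta> u = 1"
  shows "balanced S"
  unfolding balanced_def
proof (intro allI impI)
  fix w assume "is_cycle S w"
  note w = cycle_walk[OF this]
  show "cycle_sign S w = 1"
    using walk_sign_switching[OF assms, where w = "last w # w"] w
    by (simp add: cycle_sign_walk assms(2))
qed

lemma rtrancl_adjacency_walk:
  assumes "(v, u) \<in> (adjacency S)\<^sup>*"
  shows "\<exists>w. w \<noteq> [] \<and> hd w = v \<and> last w = u \<and> walk S w"
  using assms
proof induction
  case base
  show ?case by (intro exI[of _ "[v]"]) simp
next
  case (step y z)
  then obtain w where "w \<noteq> []" "hd w = v" "last w = y" "walk S w" by blast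
  then show ?case using step.hyps
    by (intro exI[of _ "w @ [z]"]) (auto simp: adjacency_def successively_append_iff)
qed

text \<open>The converse half of Harary's criterion. Let \<open>\<theta> u\<close> be the sign of a
  chosen walk from \<open>v0\<close> to \<open>u\<close>. The walk to \<open>u\<close>, the edge
  from \<open>u\<close> to \<open>v\<close> and the reversed walk to \<open>v\<close> form a closed
  walk, which balance makes positive.\<close>

lemma switching_exists:
  assumes S: "signed_graph S" and bal: "balanced S"
    and conn: "\<And>u. u \<in> verts S \<Longrightarrow> (v0, u) \<in> (adjacency S)\<^sup>*"
  shows "\<exists>\<theta>. (\<forall>u. \<theta> u * \<theta> u = 1) \<and>
           (\<forall>u v. {u, v} \<in> edges S \<longrightarrow> sign S {u, v} = \<theta> u * \<theta> v)"
proof -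
  define p where "p u = (SOME w. w \<noteq> [] \<and> hd w = v0 \<and> last w = u \<and> walk S w)" for u
  have p: "p u \<noteq> []" "hd (p u) = v0" "last (p u) = u" "walk S (p u)"
    if "u \<in> verts S" for u
    using someI_ex[OF rtrancl_adjacency_walk[OF conn[OF that]], folded p_def] by blast+
  \<comment> \<open>The value 1 outside the vertex set keeps the square of \<open>\<theta>\<close>
    equal to 1 for every argument.\<close>
  define \<theta> where "\<theta> u = (if u \<in> verts S then walk_sign (sign S) (p u) else 1)" for u
  have sq: "\<theta> u * \<theta> u = 1" for u
    using walk_sign_cases[OF S p(4)[of u]] by (auto simp: \<theta>_def)
  moreover have "sign S {u, v} = \<theta> u * \<theta> v" if e: "{u, v} \<in> edges S" for u v
  proof -
    have uv: "u \<in> verts S" "v \<in> verts S" using S e unfolding signed_graph_def by auto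
    note pu = p[OF uv(1)] and pv = p[OF uv(2)]
    have "walk_sign (sign S) (p u @ rev (p v)) = 1"
      using pu pv e
      by (intro balanced_closed_walk[OF S bal])
        (auto simp: successively_append_iff hd_rev last_rev insert_commute)
    then have "\<theta> u * sign S {u, v} * \<theta> v = 1"
      using pu pv uv by (simp add: walk_sign_append walk_sign_rev hd_rev \<theta>_def)
    then have "\<theta> u * \<theta> v = (\<theta> u * \<theta> u) * sign S {u, v} * (\<theta> v * \<theta> v)"
      by (simp add: algebra_simps)
    then show ?thesis by (simp add: sq)
  qed
  ultimately show ?thesis by blast
qed

section \<open>Connected components and their switching functions\<close>

definition component :: "'v signed_graph \<Rightarrow> 'v \<Rightarrow> 'v set" where
  "component S v = (adjacency S)\<^sup>* `` {v}"

text \<open>Balanced components are recorded by their vertex sets, which later index a basis of an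
  eigenspace.\<close>

definition balanced_classes :: "'v signed_graph \<Rightarrow> 'v set set" where
  "balanced_classes S = {component S v |v. v \<in> verts S \<and> balanced (induced S (component S v))}"

lemma num_balanced_eq_card: "num_balanced S = card (balanced_classes S)"
proof -
  have "{C \<in> components S. balanced C} = induced S ` balanced_classes S"
    by (auto simp: components_def balanced_classes_def component_def)
  moreover have "inj_on (induced S) (balanced_classes S)"
    by (auto simp: inj_on_def induced_def)
  ultimately show ?thesis by (simp add: num_balanced_def card_image)
qed

lemma component_refl: "v \<in> component S v"
  by (simp add: component_def)

lemma component_edge: "u \<in> component S v \<Longrightarrow> {u, w} \<in> edges S \<Longrightarrow> w \<in> component S v"
  by (auto simp: component_def adjacency_def intro: rtrancl_into_rtrancl)

lemma component_eq:
  assumes "u \<in> component S v"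
  shows "component S u = component S v"
proof -
  have "sym (adjacency S)" by (auto simp: sym_def adjacency_def insert_commute)
  then have "(u, v) \<in> (adjacency S)\<^sup>*"
    using assms by (auto simp: component_def dest: symD[OF sym_rtrancl])
  then show ?thesis using assms by (auto simp: component_def intro: rtrancl_trans)
qed

lemma component_subset:
  assumes "signed_graph S" "v \<in> verts S"
  shows "component S v \<subseteq> verts S"
proof
  fix u assume "u \<in> component S v"
  then have "(v, u) \<in> (adjacency S)\<^sup>*" by (simp add: component_def)
  then show "u \<in> verts S"
    by induction (use assms in \<open>auto simp: adjacency_def signed_graph_def\<close>)
qed

lemma finite_balanced_classes:
  assumes "signed_graph S"
  shows "finite (balanced_classes S)"
proof -
  have "balanced_classes S \<subseteq> component S ` verts S"
    by (auto simp: balanced_classes_def)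
  then show ?thesis
    using assms by (elim finite_subset) (simp add: signed_graph_def)
qed

lemma balanced_class_cases:
  assumes "K \<in> balanced_classes S" "u \<in> K"
  shows "K = component S u"
  using assms component_eq by (fastforce simp: balanced_classes_def)

text \<open>Balance gives a switching function on the induced subgraph. No edge leaves a component,
  so the formula covers every edge of \<open>S\<close> that meets \<open>K\<close>.\<close>

lemma balanced_class_switching:
  assumes S: "signed_graph S" and K: "K \<in> balanced_classes S"
  shows "\<exists>\<theta>. (\<forall>u. \<theta> u * \<theta> u = (1::real)) \<and>
           (\<forall>u v. u \<in> K \<longrightarrow> {u, v} \<in> edges S \<longrightarrow> sign S {u, v} = \<theta> u * \<theta> v)"
proof -
  obtain v0 where v0: "v0 \<in> verts S" "K = component S v0" "balanced (induced S K)"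
    using K by (auto simp: balanced_classes_def)
  have sub: "K \<subseteq> verts S" using component_subset[OF S v0(1)] v0(2) by simp
  then have SK: "signed_graph (induced S K)"
    using S by (auto simp: signed_graph_def induced_def intro: finite_subset)
  \<comment> \<open>Reachability is known in \<open>S\<close>; all vertices on the way lie in
    \<open>K\<close>, so each step is also an edge of the induced graph.\<close>
  have conn: "(v0, u) \<in> (adjacency (induced S K))\<^sup>*" if "u \<in> verts (induced S K)" for u
  proof -
    have "(v0, u) \<in> (adjacency S)\<^sup>*"
      using that v0(2) by (simp add: component_def induced_def)
    then show ?thesis
    proof induction
      case (step y z)
      then have "y \<in> K" "z \<in> K"
        using v0(2) by (auto simp: component_def intro: rtrancl_into_rtrancl)
      then have "(y, z) \<in> adjacency (induced S K)"
        using step.hyps by (auto simp: adjacency_def induced_def)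
      then show ?case using step.IH by (rule rtrancl_into_rtrancl[rotated])
    qed simp
  qed
  obtain \<theta> where t: "\<And>u. \<theta> u * \<theta> u = (1::real)"
    "\<And>u v. {u, v} \<in> edges (induced S K) \<Longrightarrow> sign (induced S K) {u, v} = \<theta> u * \<theta> v"
    using switching_exists[OF SK v0(3) conn] by blast
  have "sign S {u, v} = \<theta> u * \<theta> v" if "u \<in> K" "{u, v} \<in> edges S" for u v
    using t(2)[of u v] that component_edge[of u S v0 v] v0(2) by (simp add: induced_def)
  with t(1) show ?thesis by blast
qed

text \<open>If \<open>x v \<noteq> 0\<close>, then \<open>\<bar>x\<bar>\<close> is constant on the component, and \<open>sgn x\<close> is a switching function
  that witnesses balance.\<close>

lemma switching_zero_unbalanced:
  assumes S: "signed_graph S" and v: "v \<in> verts S"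
    and x: "\<And>u w. {u, w} \<in> edges S \<Longrightarrow> x w = sign S {u, w} * x u"
    and nb: "component S v \<notin> balanced_classes S"
  shows "x v = (0::real)"
proof (rule ccontr)
  assume nz: "x v \<noteq> 0"
  have abs: "\<bar>x u\<bar> = \<bar>x v\<bar>" if "u \<in> component S v" for u
  proof -
    have "(v, u) \<in> (adjacency S)\<^sup>*" using that by (simp add: component_def)
    then show ?thesis
    proof induction
      case (step y z)
      then have "{y, z} \<in> edges S" by (simp add: adjacency_def)
      then have "\<bar>x z\<bar> = \<bar>x y\<bar>" using x[of y z] sign_edge[OF S, of "{y, z}"] by auto
      then show ?case using step.IH by simp
    qed simp
  qed
  \<comment> \<open>The default 1 off the component makes \<open>\<theta>\<close> square to 1
    everywhere, as \<open>balanced_if_switching\<close> demands.\<close>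
  define \<theta> where "\<theta> u = (if u \<in> component S v then sgn (x u) else 1)" for u
  have "\<theta> u * \<theta> u = 1" for u
    using abs[of u] nz by (auto simp: \<theta>_def sgn_if)
  moreover have "sign (induced S (component S v)) {u, w} = \<theta> u * \<theta> w"
    if "{u, w} \<in> edges (induced S (component S v))" for u w
  proof -
    have e: "{u, w} \<in> edges S" and m: "u \<in> component S v" "w \<in> component S v"
      using that by (auto simp: induced_def)
    have "x u \<noteq> 0" using abs[OF m(1)] nz by auto
    then show ?thesis
      using x[OF e] sign_edge[OF S e] m by (auto simp: \<theta>_def induced_def sgn_if)
  qed
  ultimately have "balanced (induced S (component S v))"
    by (intro balanced_if_switching[where \<theta> = \<theta>])
  then show False using nb v by (auto simp: balanced_classes_def)
qed

subsection \<open>The eigenspace of the degree\<close>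

text \<open>Each \<open>b K\<close> has a pivot coordinate \<open>p K\<close> at which all other
  members vanish. Reading a linear combination at the pivots isolates its coefficients, which gives
  independence.\<close>

lemma kernel_dim_eq_card:
  fixes M :: "real mat" and b :: "'k \<Rightarrow> real vec"
  assumes M: "M \<in> carrier_mat r n" and F: "finite F"
    and b: "\<And>K. K \<in> F \<Longrightarrow> b K \<in> mat_kernel M"
    and p: "\<And>K. K \<in> F \<Longrightarrow> p K < n"
    and bp: "\<And>K L. K \<in> F \<Longrightarrow> L \<in> F \<Longrightarrow> b K $ p L \<noteq> 0 \<longleftrightarrow> K = L"
    and span: "\<And>x. x \<in> mat_kernel M \<Longrightarrow> \<exists>c. \<forall>i<n. x $ i = (\<Sum>K\<in>F. c K * b K $ i)"
  shows "kernel_dim M = card F"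
proof -
  interpret kernel r n M by unfold_locales (rule M)
  have inj: "inj_on b F"
    using bp by (intro inj_onI) metis
  have sub: "b ` F \<subseteq> mat_kernel M" using b by auto
  have lc: "lincomb a (b ` F) $ i = (\<Sum>K\<in>F. a (b K) * b K $ i)" if "i < n" for a i
    using lincomb_index[OF that sub, of a] by (simp add: sum.reindex[OF inj])
  have "lin_indpt (b ` F)"
  proof (rule Ker.finite_lin_indpt2)
    fix a assume z: "lincomb a (b ` F) = 0\<^sub>v n"
    show "\<forall>v\<in>b ` F. a v = 0"
    proof safe
      fix L assume L: "L \<in> F"
      have "0 = (\<Sum>K\<in>F. a (b K) * b K $ p L)"
        using lc[OF p[OF L], of a] z p[OF L] by simp
      also have "\<dots> = (\<Sum>K\<in>F. if K = L then a (b L) * b L $ p L else 0)"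
        using bp[OF _ L] by (intro sum.cong) auto
      also have "\<dots> = a (b L) * b L $ p L" using F L by simp
      finally show "a (b L) = 0" using bp[OF L L] by simp
    qed
  qed (use F sub in auto)
  moreover have "span (b ` F) = mat_kernel M"
  proof
    show "span (b ` F) \<subseteq> mat_kernel M"
      using Ker.span_is_subset2[of "b ` F"] sub by simp
    show "mat_kernel M \<subseteq> span (b ` F)"
    proof
      fix x assume x: "x \<in> mat_kernel M"
      then obtain c where c: "\<forall>i<n. x $ i = (\<Sum>K\<in>F. c K * b K $ i)" using span by blast
      \<comment> \<open>Coefficients on the index set are carried to the vectors through the inverse
        of \<open>b\<close>, which is injective because of the pivots.\<close>
      define a where "a = c \<circ> the_inv_into F b"
      have a: "a (b K) = c K" if "K \<in> F" for K
        using that inj by (simp add: a_def the_inv_into_f_f)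
      have "lincomb a (b ` F) \<in> mat_kernel M"
        using sub by (intro Ker.lincomb_closed) auto
      then have l: "lincomb a (b ` F) \<in> carrier_vec n" and "x \<in> carrier_vec n"
        using mat_kernelD(1)[OF M] x by blast+
      then have "x = lincomb a (b ` F)"
        using c by (intro eq_vecI) (simp_all add: lc a cong: sum.cong)
      then show "x \<in> span (b ` F)"
        using F sub by (auto simp: Ker.finite_span)
    qed
  qed
  ultimately have "basis (b ` F)" using sub by (simp add: Ker.basis_def)
  then show ?thesis
    using Ker.dim_basis[of "b ` F"] F inj by (simp add: card_image)
qed

section \<open>Incidence and adjacency matrices of a regular signed graph\<close>

lemma finite_edges:
  assumes "signed_graph S"
  shows "finite (edges S)"
  using assms by (intro finite_subset[of "edges S" "Pow (verts S)"]) (auto simp: signed_graph_def)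

lemma edge_doubleton:
  assumes "signed_graph S" "e \<in> edges S"
  obtains u v where "e = {u, v}" "u \<noteq> v" "u \<in> verts S" "v \<in> verts S"
  using assms unfolding signed_graph_def by (metis card_2_iff insert_subset)

lemma incidence_mat_carrier:
  "incidence_mat \<eta> vs es \<in> carrier_mat (length vs) (length es)"
  by (simp add: incidence_mat_def)

lemma adjacency_mat_carrier: "adjacency_mat S vs \<in> carrier_mat (length vs) (length vs)"
  by (simp add: adjacency_mat_def)

lemma adjacency_mat_symmetric: "transpose_mat (adjacency_mat S vs) = adjacency_mat S vs"
  by (rule eq_matI) (auto simp: adjacency_mat_def insert_commute)

text \<open>A diagonal entry counts the edges at a vertex. Off the diagonal only the edge joining
  the two vertices, if present, meets both, and it contributes minus its sign by the product rule
  for \<open>\<eta>\<close>.\<close>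

lemma incidence_mat_mult_transpose:
  assumes S: "signed_graph S" and H: "incidence S \<eta>" and k: "regular S k"
    and vs: "set vs = verts S" "distinct vs" and es: "set es = edges S" "distinct es"
  shows "incidence_mat \<eta> vs es * transpose_mat (incidence_mat \<eta> vs es)
    = real k \<cdot>\<^sub>m 1\<^sub>m (length vs) - adjacency_mat S vs"
proof (rule eq_matI)
  fix i j
  assume "i < dim_row (real k \<cdot>\<^sub>m 1\<^sub>m (length vs) - adjacency_mat S vs)"
    and "j < dim_col (real k \<cdot>\<^sub>m 1\<^sub>m (length vs) - adjacency_mat S vs)"
  then have ij: "i < length vs" "j < length vs" by (auto simp: adjacency_mat_def)
  define u v where "u = vs ! i" and "v = vs ! j"
  have uv: "u \<in> verts S" "v \<in> verts S"
    unfolding u_def v_def vs(1)[symmetric] using ij by simp_all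
  have eq: "u = v \<longleftrightarrow> i = j"
    unfolding u_def v_def using nth_eq_iff_index_eq[OF vs(2) ij] .
  note inc = incidence_entry[OF H]
  have "(incidence_mat \<eta> vs es * transpose_mat (incidence_mat \<eta> vs es)) $$ (i, j)
      = (\<Sum>a<length es. \<eta> u (es ! a) * \<eta> v (es ! a))"
    using ij by (simp add: incidence_mat_def scalar_prod_def u_def v_def lessThan_atLeast0)
  also have "\<dots> = (\<Sum>e\<in>edges S. \<eta> u e * \<eta> v e)"
    using sum.reindex_bij_betw[OF bij_betw_nth[OF es(2) refl es(1)[symmetric]]] .
  also have "\<dots> = (if i = j then real k else 0)
      - (if {u, v} \<in> edges S then sign S {u, v} else 0)"
  proof (cases "i = j")
    case True
    then have "u = v" using eq by simp
    have "(\<Sum>e\<in>edges S. \<eta> u e * \<eta> u e) = (\<Sum>e\<in>edges S. if u \<in> e then 1 else 0)"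
    proof (rule sum.cong[OF refl])
      fix e assume "e \<in> edges S"
      from inc[OF uv(1) this] show "\<eta> u e * \<eta> u e = (if u \<in> e then 1 else 0)"
        by (auto split: if_splits)
    qed
    also have "\<dots> = real (vdegree S u)"
      using finite_edges[OF S] by (simp add: sum.If_cases vdegree_def Int_def)
    also have "\<dots> = real k" using k uv by (simp add: regular_def)
    finally show ?thesis using True \<open>u = v\<close> edge_neq[OF S, of u v] by auto
  next
    case False
    then have ne: "u \<noteq> v" using eq by simp
    have z: "\<eta> u e * \<eta> v e = 0" if e: "e \<in> edges S" "e \<noteq> {u, v}" for e
    proof -
      obtain a b where "e = {a, b}" using edge_doubleton[OF S e(1)] .
      then have "\<not> (u \<in> e \<and> v \<in> e)" using e(2) ne by auto
      then show ?thesis using inc[OF uv(1) e(1)] inc[OF uv(2) e(1)] by auto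
    qed
    have "(\<Sum>e\<in>edges S. \<eta> u e * \<eta> v e)
        = (\<Sum>e\<in>edges S. if e = {u, v} then \<eta> u e * \<eta> v e else 0)"
      using z by (intro sum.cong) auto
    also have "\<dots> = (if {u, v} \<in> edges S then \<eta> u {u, v} * \<eta> v {u, v} else 0)"
      using finite_edges[OF S] by simp
    finally show ?thesis using False H ne by (simp add: incidence_def)
  qed
  finally show "(incidence_mat \<eta> vs es * transpose_mat (incidence_mat \<eta> vs es)) $$ (i, j)
      = (real k \<cdot>\<^sub>m 1\<^sub>m (length vs) - adjacency_mat S vs) $$ (i, j)"
    using ij by (simp add: adjacency_mat_def u_def v_def)
qed (auto simp: adjacency_mat_def incidence_mat_def)

text \<open>\<open>char_matrix\<close> is here minus a Gram matrix, whose kernel is that of the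
  transposed incidence matrix. Each edge gives one equation
  \<open>\<eta> u e * x u + \<eta> v e * x v = 0\<close>, and the product rule for
  \<open>\<eta>\<close> turns it into the switching relation.\<close>

lemma adjacency_kernel_iff:
  assumes S: "signed_graph S" and k: "regular S k"
    and vs: "set vs = verts S" "distinct vs" and x: "x \<in> carrier_vec (length vs)"
  shows "x \<in> mat_kernel (char_matrix (adjacency_mat S vs) (real k)) \<longleftrightarrow>
    (\<forall>i<length vs. \<forall>j<length vs. {vs ! i, vs ! j} \<in> edges S \<longrightarrow>
       x $ j = sign S {vs ! i, vs ! j} * x $ i)"
proof -
  let ?n = "length vs"
  obtain \<eta> where H: "incidence S \<eta>" using incidence_exists[OF S] by blast
  obtain es where es: "set es = edges S" "distinct es"
    using finite_distinct_list[OF finite_edges[OF S]] by blast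
  define B where "B = incidence_mat \<eta> vs es"
  have B: "B \<in> carrier_mat ?n (length es)" unfolding B_def by (rule incidence_mat_carrier)
  have cm: "char_matrix (adjacency_mat S vs) (real k) = - (B * transpose_mat B)"
    unfolding B_def incidence_mat_mult_transpose[OF S H k vs es]
    by (rule eq_matI) (auto simp: char_matrix_def adjacency_mat_def)
  have BB: "B * transpose_mat B \<in> carrier_mat ?n ?n" using B by simp
  have "x \<in> mat_kernel (char_matrix (adjacency_mat S vs) (real k)) \<longleftrightarrow>
      B * transpose_mat B *\<^sub>v x = 0\<^sub>v ?n"
  proof -
    have "- (B * transpose_mat B) \<in> carrier_mat ?n ?n" using BB by simp
    from mat_kernel[OF this] have "x \<in> mat_kernel (- (B * transpose_mat B)) \<longleftrightarrow>
        - (B * transpose_mat B) *\<^sub>v x = 0\<^sub>v ?n"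
      using x by blast
    also have "- (B * transpose_mat B) *\<^sub>v x = - (B * transpose_mat B *\<^sub>v x)"
      using BB x by (intro uminus_mult_mat_vec) auto
    also have "- (B * transpose_mat B *\<^sub>v x) = 0\<^sub>v ?n \<longleftrightarrow> B * transpose_mat B *\<^sub>v x = 0\<^sub>v ?n"
      unfolding vec_eq_iff by auto
    finally show ?thesis unfolding cm .
  qed
  also have "\<dots> \<longleftrightarrow> transpose_mat B *\<^sub>v x = 0\<^sub>v (length es)"
  proof
    assume "B * transpose_mat B *\<^sub>v x = 0\<^sub>v ?n"
    then show "transpose_mat B *\<^sub>v x = 0\<^sub>v (length es)"
      using scalar_prod_gram[OF B x] B x by (intro scalar_prod_self_eq_0) auto
  next
    assume *: "transpose_mat B *\<^sub>v x = 0\<^sub>v (length es)"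
    have "B *\<^sub>v 0\<^sub>v (length es) = 0\<^sub>v ?n"
      using B by (intro eq_vecI) simp_all
    then show "B * transpose_mat B *\<^sub>v x = 0\<^sub>v ?n"
      using assoc_mult_mat_vec[OF B _ x, of "transpose_mat B"] B * by simp
  qed
  also have "\<dots> \<longleftrightarrow> (\<forall>e\<in>edges S. (\<Sum>i<?n. \<eta> (vs ! i) e * x $ i) = 0)"
  proof -
    have "(transpose_mat B *\<^sub>v x) $ a = (\<Sum>i<?n. \<eta> (vs ! i) (es ! a) * x $ i)"
      if "a < length es" for a
      using that x by (simp add: B_def incidence_mat_def scalar_prod_def lessThan_atLeast0)
    moreover have "transpose_mat B *\<^sub>v x = 0\<^sub>v (length es) \<longleftrightarrow>
        (\<forall>a<length es. (transpose_mat B *\<^sub>v x) $ a = 0)"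
      using B by (auto simp: vec_eq_iff)
    ultimately show ?thesis by (simp add: es(1)[symmetric] all_set_conv_all_nth)
  qed
  also have "\<dots> \<longleftrightarrow> (\<forall>i<?n. \<forall>j<?n. {vs ! i, vs ! j} \<in> edges S \<longrightarrow>
       x $ j = sign S {vs ! i, vs ! j} * x $ i)"
  proof -
    have key: "(\<Sum>i<?n. \<eta> (vs ! i) e * x $ i) = 0 \<longleftrightarrow> x $ b = sign S e * x $ a"
      if ab: "a < ?n" "b < ?n" "e = {vs ! a, vs ! b}" "e \<in> edges S" for a b e
    proof -
      have ne: "vs ! a \<noteq> vs ! b" using edge_neq[OF S] ab by blast
      then have "a \<noteq> b" by auto
      have V: "vs ! i \<in> verts S" if "i < ?n" for i
        unfolding vs(1)[symmetric] using that by simp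
      \<comment> \<open>The column of \<open>e\<close> is supported on its two endpoints, so the sum
        has two terms.\<close>
      have "vs ! i \<notin> e" if "i < ?n" "i \<notin> {a, b}" for i
        using that ab vs(2) by (auto simp: nth_eq_iff_index_eq)
      then have "(\<Sum>i<?n. \<eta> (vs ! i) e * x $ i) = (\<Sum>i\<in>{a, b}. \<eta> (vs ! i) e * x $ i)"
        using incidence_entry[OF H V ab(4)] ab
        by (intro sum.mono_neutral_right) auto
      also have "\<dots> = \<eta> (vs ! a) e * x $ a + \<eta> (vs ! b) e * x $ b"
        using \<open>a \<noteq> b\<close> by simp
      finally have sum: "(\<Sum>i<?n. \<eta> (vs ! i) e * x $ i) = \<dots>" .
      have "\<eta> (vs ! a) e * \<eta> (vs ! b) e = - sign S e"
        using H ne ab unfolding incidence_def by blast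
      moreover have "\<eta> (vs ! a) e = 1 \<or> \<eta> (vs ! a) e = -1"
        "\<eta> (vs ! b) e = 1 \<or> \<eta> (vs ! b) e = -1"
        using incidence_entry[OF H V[OF ab(1)] ab(4)] incidence_entry[OF H V[OF ab(2)] ab(4)] ab(3)
        by auto
      ultimately show ?thesis unfolding sum by auto
    qed
    show ?thesis
    proof (intro iffI allI impI ballI)
      fix e assume "e \<in> edges S" and *: "\<forall>i<?n. \<forall>j<?n. {vs ! i, vs ! j} \<in> edges S \<longrightarrow>
         x $ j = sign S {vs ! i, vs ! j} * x $ i"
      obtain u v where uv: "e = {u, v}" "u \<in> verts S" "v \<in> verts S"
        using edge_doubleton[OF S \<open>e \<in> edges S\<close>] by metis
      then obtain a b where "a < ?n" "b < ?n" "e = {vs ! a, vs ! b}"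
        by (metis in_set_conv_nth vs(1))
      then show "(\<Sum>i<?n. \<eta> (vs ! i) e * x $ i) = 0"
        using key[of a b e] * \<open>e \<in> edges S\<close> by blast
    qed (use key in blast)
  qed
  finally show ?thesis .
qed

text \<open>Each balanced component contributes one basis vector, namely its switching function
  extended by zero.\<close>

lemma kernel_dim_adjacency:
  assumes S: "signed_graph S" and k: "regular S k"
    and vs: "set vs = verts S" "distinct vs"
  shows "kernel_dim (char_matrix (adjacency_mat S vs) (real k)) = num_balanced S"
proof -
  let ?n = "length vs" and ?M = "char_matrix (adjacency_mat S vs) (real k)"
  have M: "?M \<in> carrier_mat ?n ?n" by (intro char_matrix_closed adjacency_mat_carrier)
  let ?sw = "\<lambda>K \<theta>. (\<forall>u. \<theta> u * \<theta> u = (1::real)) \<and>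
      (\<forall>u v. u \<in> K \<longrightarrow> {u, v} \<in> edges S \<longrightarrow> sign S {u, v} = \<theta> u * \<theta> v)"
  define \<theta> where "\<theta> K = (SOME t. ?sw K t)" for K
  have t: "\<theta> K u * \<theta> K u = 1"
    and te: "\<And>v. u \<in> K \<Longrightarrow> {u, v} \<in> edges S \<Longrightarrow> sign S {u, v} = \<theta> K u * \<theta> K v"
    if "K \<in> balanced_classes S" for K u
    using someI_ex[OF balanced_class_switching[OF S that], folded \<theta>_def] by blast+
  define b where "b K = vec ?n (\<lambda>i. if vs ! i \<in> K then \<theta> K (vs ! i) else 0)" for K
  \<comment> \<open>Any position in \<open>K\<close> is a pivot, since distinct components are
    disjoint and \<open>\<theta> K\<close> never vanishes.\<close>
  define p where "p K = (SOME i. i < ?n \<and> vs ! i \<in> K)" for K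
  have p: "p K < ?n" "vs ! p K \<in> K" if K: "K \<in> balanced_classes S" for K
  proof -
    obtain v where "v \<in> verts S" "v \<in> K"
      using K component_refl by (fastforce simp: balanced_classes_def)
    then have "\<exists>i. i < ?n \<and> vs ! i \<in> K" by (metis in_set_conv_nth vs(1))
    from someI_ex[OF this, folded p_def] show "p K < ?n" "vs ! p K \<in> K" by auto
  qed
  have closed: "u \<in> K \<longleftrightarrow> v \<in> K" if "K \<in> balanced_classes S" "{u, v} \<in> edges S" for K u v
  proof
    assume u: "u \<in> K"
    show "v \<in> K"
      using component_edge[of u S u v] component_refl[of u S] that(2)
      by (simp add: balanced_class_cases[OF that(1) u])
  next
    assume v: "v \<in> K"
    show "u \<in> K"
      using component_edge[of v S v u] component_refl[of v S] that(2)
      by (simp add: balanced_class_cases[OF that(1) v] insert_commute)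
  qed
  have disj: "K = L" if "K \<in> balanced_classes S" "L \<in> balanced_classes S" "u \<in> K" "u \<in> L" for K L u
    using balanced_class_cases[OF that(1,3)] balanced_class_cases[OF that(2,4)] by simp
  have "kernel_dim ?M = card (balanced_classes S)"
  proof (rule kernel_dim_eq_card[OF M finite_balanced_classes[OF S], of b p])
    fix K assume K: "K \<in> balanced_classes S"
    have "b K \<in> carrier_vec ?n" by (simp add: b_def)
    then show "b K \<in> mat_kernel ?M"
      unfolding adjacency_kernel_iff[OF S k vs \<open>b K \<in> _\<close>]
    proof (intro allI impI)
      fix i j assume ij: "i < ?n" "j < ?n" and e: "{vs ! i, vs ! j} \<in> edges S"
      show "b K $ j = sign S {vs ! i, vs ! j} * b K $ i"
      proof (cases "vs ! i \<in> K")
        case True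
        have "b K $ j = (\<theta> K (vs ! i) * \<theta> K (vs ! i)) * \<theta> K (vs ! j)"
          using True closed[OF K e] ij t[OF K] by (simp add: b_def)
        then show ?thesis
          using True ij te[OF K True e] by (simp add: b_def algebra_simps)
      next
        case False
        then show ?thesis using closed[OF K e] ij by (simp add: b_def)
      qed
    qed
    show "p K < ?n" by (rule p[OF K])
  next
    fix K L assume KL: "K \<in> balanced_classes S" "L \<in> balanced_classes S"
    have "\<theta> K u \<noteq> 0" for u using t[OF KL(1), of u] by auto
    then show "b K $ p L \<noteq> 0 \<longleftrightarrow> K = L"
      using p[OF KL(2)] disj[OF KL, of "vs ! p L"] by (cases "K = L") (auto simp: b_def)
  next
    fix x assume x: "x \<in> mat_kernel ?M"
    then have xc: "x \<in> carrier_vec ?n" using mat_kernel_carrier[OF M] by auto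
    \<comment> \<open>The kernel vector is reread as a function \<open>y\<close> on vertices, so
      that the edge equations can be followed along paths.\<close>
    define idx where "idx v = (SOME i. i < ?n \<and> vs ! i = v)" for v
    have idx: "idx v < ?n" "vs ! idx v = v" if "v \<in> verts S" for v
    proof -
      have "\<exists>i. i < ?n \<and> vs ! i = v" using that by (metis in_set_conv_nth vs(1))
      from someI_ex[OF this, folded idx_def] show "idx v < ?n" "vs ! idx v = v" by auto
    qed
    define y where "y v = x $ idx v" for v
    have yx: "y (vs ! i) = x $ i" if "i < ?n" for i
    proof -
      have "vs ! i \<in> verts S" unfolding vs(1)[symmetric] using that by simp
      note i = idx[OF this]
      have "idx (vs ! i) = i" using nth_eq_iff_index_eq[OF vs(2) i(1) that] i(2) by simp
      then show ?thesis by (simp add: y_def)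
    qed
    have y: "y w = sign S {u, w} * y u" if e: "{u, w} \<in> edges S" for u w
    proof -
      have "u \<in> verts S" "w \<in> verts S" using S e unfolding signed_graph_def by auto
      note u = idx[OF this(1)] and w = idx[OF this(2)]
      have "{vs ! idx u, vs ! idx w} \<in> edges S" using e u(2) w(2) by simp
      then have "x $ idx w = sign S {vs ! idx u, vs ! idx w} * x $ idx u"
        by (rule x[unfolded adjacency_kernel_iff[OF S k vs xc], rule_format, OF u(1) w(1)])
      then show ?thesis using u(2) w(2) by (simp add: y_def)
    qed
    \<comment> \<open>Along an edge in \<open>K\<close> both \<open>\<theta> K\<close> and
      \<open>y\<close> are multiplied by the sign, so their product is unchanged. Thus
      \<open>y\<close> is a multiple of \<open>\<theta> K\<close> on \<open>K\<close>.\<close>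
    have const: "\<theta> K u * y u = \<theta> K v * y v" if K: "K \<in> balanced_classes S" and uv: "u \<in> K" "v \<in> K" for K u v
    proof -
      have "(u, v) \<in> (adjacency S)\<^sup>*"
        using uv balanced_class_cases[OF K uv(1)] by (auto simp: component_def)
      then have "v \<in> K \<and> \<theta> K u * y u = \<theta> K v * y v"
      proof induction
        case (step a c)
        then have e: "{a, c} \<in> edges S" by (simp add: adjacency_def)
        have "\<theta> K c * y c = (\<theta> K c * \<theta> K c) * (\<theta> K a * y a)"
          using y[OF e] te[OF K _ e] step.IH by simp
        then show ?case using step.IH t[OF K] closed[OF K e] by simp
      qed (simp add: uv)
      then show ?thesis by simp
    qed
    \<comment> \<open>The constant product, read at the pivot, is the coefficient of
      \<open>b K\<close>.\<close>
    define c where "c K = \<theta> K (vs ! p K) * y (vs ! p K)" for K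
    have "x $ i = (\<Sum>K\<in>balanced_classes S. c K * b K $ i)" if i: "i < ?n" for i
    proof -
      let ?v = "vs ! i" and ?C = "component S (vs ! i)"
      have v: "?v \<in> verts S" unfolding vs(1)[symmetric] using i by simp
      \<comment> \<open>Only the component of \<open>?v\<close> can contribute at position
        \<open>i\<close>; if it is unbalanced, the sum is 0, and so is \<open>x $ i\<close>.\<close>
      have *: "(\<Sum>K\<in>balanced_classes S. c K * b K $ i) =
          (\<Sum>K\<in>balanced_classes S. if K = ?C then c ?C * \<theta> ?C ?v else 0)"
      proof (rule sum.cong[OF refl])
        fix K assume K: "K \<in> balanced_classes S"
        show "c K * b K $ i = (if K = ?C then c ?C * \<theta> ?C ?v else 0)"
          using i balanced_class_cases[OF K, of ?v] component_refl[of ?v S]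
          by (cases "?v \<in> K") (auto simp: b_def)
      qed
      show ?thesis
      proof (cases "?C \<in> balanced_classes S")
        case True
        have "c ?C * \<theta> ?C ?v = \<theta> ?C ?v * y ?v * \<theta> ?C ?v"
          unfolding c_def using const[OF True p(2)[OF True] component_refl] by simp
        also have "\<dots> = (\<theta> ?C ?v * \<theta> ?C ?v) * y ?v" by simp
        also have "\<dots> = x $ i" using t[OF True] yx[OF i] by simp
        finally show ?thesis unfolding * using finite_balanced_classes[OF S] True by simp
      next
        case False
        then have "y ?v = 0" using switching_zero_unbalanced[OF S v y] by blast
        then show ?thesis unfolding * using finite_balanced_classes[OF S] False yx[OF i] by simp
      qed
    qed
    then show "\<exists>c. \<forall>i<?n. x $ i = (\<Sum>K\<in>balanced_classes S. c K * b K $ i)" by blast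
  qed
  then show ?thesis by (simp add: num_balanced_eq_card)
qed

text \<open>For an eigenvector \<open>v\<close>, the Gram identity equates
  \<open>(real k - a) * (v \<bullet> v)\<close> with a squared length, and
  \<open>v \<bullet> v\<close> is positive.\<close>

lemma eigenvals_adjacency_le:
  assumes S: "signed_graph S" and k: "regular S k"
    and vs: "set vs = verts S" "distinct vs" and a: "a \<in># eigenvals (adjacency_mat S vs)"
  shows "a \<le> real k"
proof -
  let ?n = "length vs" and ?A = "adjacency_mat S vs"
  note A = adjacency_mat_carrier[of S vs]
  obtain \<eta> where H: "incidence S \<eta>" using incidence_exists[OF S] by blast
  obtain es where es: "set es = edges S" "distinct es"
    using finite_distinct_list[OF finite_edges[OF S]] by blast
  define B where "B = incidence_mat \<eta> vs es"
  have B: "B \<in> carrier_mat ?n (length es)" unfolding B_def by (rule incidence_mat_carrier)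
  have "char_poly ?A \<noteq> 0" using degree_monic_char_poly[OF A] by auto
  then have "eigenvalue ?A a"
    using a by (simp add: eigenvals_def eigenvalue_root_char_poly[OF A])
  then obtain v where v: "v \<in> carrier_vec ?n" "v \<noteq> 0\<^sub>v ?n" "?A *\<^sub>v v = a \<cdot>\<^sub>v v"
    using A by (auto simp: eigenvalue_def eigenvector_def)
  have "(real k \<cdot>\<^sub>m 1\<^sub>m ?n) *\<^sub>v v = real k \<cdot>\<^sub>v v"
    using v(1) by (intro eq_vecI) (auto simp: scalar_prod_left_unit)
  then have "B * transpose_mat B *\<^sub>v v = real k \<cdot>\<^sub>v v - a \<cdot>\<^sub>v v"
    unfolding B_def incidence_mat_mult_transpose[OF S H k vs es]
    using v A by (simp add: minus_mult_distrib_mat_vec[of _ ?n ?n])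
  also have "\<dots> = (real k - a) \<cdot>\<^sub>v v"
    by (intro eq_vecI) (auto simp: algebra_simps)
  finally have "B * transpose_mat B *\<^sub>v v = (real k - a) \<cdot>\<^sub>v v" .
  then have "(real k - a) * (v \<bullet> v) = (transpose_mat B *\<^sub>v v) \<bullet> (transpose_mat B *\<^sub>v v)"
    using scalar_prod_gram[OF B v(1)] v(1) by simp
  then have "0 \<le> (real k - a) * (v \<bullet> v)" by (simp add: scalar_prod_self_nonneg)
  moreover have "0 < v \<bullet> v"
    using scalar_prod_self_nonneg[of v] scalar_prod_self_eq_0[OF _ v(1)] v(2) by fastforce
  ultimately show ?thesis by (simp add: zero_le_mult_iff)
qed

section \<open>Negation and the two ends of the spectrum\<close>

lemma negation_simps [simp]:
  "verts (negation S) = verts S" "edges (negation S) = edges S"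
  "sign (negation S) e = - sign S e"
  by (simp_all add: negation_def)

lemma signed_graph_negation: "signed_graph S \<Longrightarrow> signed_graph (negation S)"
  by (auto simp: signed_graph_def)

lemma regular_negation: "regular S k \<Longrightarrow> regular (negation S) k"
  by (simp add: regular_def vdegree_def)

lemma adjacency_mat_negation:
  "adjacency_mat (negation S) vs = 0 \<cdot>\<^sub>m 1\<^sub>m (length vs) - adjacency_mat S vs"
  by (rule eq_matI) (auto simp: adjacency_mat_def)

text \<open>Negating the graph reflects the spectrum at 0, so the claims about
  \<open>- real k\<close> are those about \<open>real k\<close> for the negated graph.\<close>

lemma spectrum_regular:
  assumes S: "signed_graph S" and k: "regular S k"
    and vs: "set vs = verts S" "distinct vs"
    and R: "eigenvals (adjacency_mat S vs) = R" "size R = length vs"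
  shows "count R (real k) = num_balanced S"
    and "count R (- real k) = num_balanced (negation S)"
    and "\<And>a. a \<in># R \<Longrightarrow> - real k \<le> a \<and> a \<le> real k"
proof -
  note A = adjacency_mat_carrier[of S vs]
  note S' = signed_graph_negation[OF S] and k' = regular_negation[OF k]
  have vs': "set vs = verts (negation S)" using vs by simp
  have R': "eigenvals (adjacency_mat (negation S) vs) = {#- a. a \<in># R#}"
    using eigenvals_scalar_minus[OF A R, of 0] by (simp add: adjacency_mat_negation)
  show "count R (real k) = num_balanced S"
    using count_eigenvals_symmetric[OF A adjacency_mat_symmetric R]
      kernel_dim_adjacency[OF S k vs] by simp
  have "count {#- a. a \<in># R#} (real k) = num_balanced (negation S)"
    using count_eigenvals_symmetric[OF adjacency_mat_carrier adjacency_mat_symmetric R', of "real k"]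
      kernel_dim_adjacency[OF S' k' vs' vs(2)] R(2) by simp
  moreover have "count {#- a. a \<in># R#} (real k) = count R (- real k)"
    by (induction R) auto
  ultimately show "count R (- real k) = num_balanced (negation S)" by simp
  fix a assume a: "a \<in># R"
  have "- a \<le> real k"
    using a by (intro eigenvals_adjacency_le[OF S' k' vs' vs(2)]) (simp add: R')
  then show "- real k \<le> a \<and> a \<le> real k"
    using eigenvals_adjacency_le[OF S k vs] a R(1) by auto
qed

subsection \<open>Degrees in the line graph\<close>

lemma handshake:
  assumes "signed_graph S"
  shows "(\<Sum>v\<in>verts S. vdegree S v) = 2 * card (edges S)"
proof -
  have "(\<Sum>v\<in>verts S. card {e \<in> edges S. v \<in> e}) = (\<Sum>e\<in>edges S. 2)"
  proof (rule sum_multicount_gen)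
    show "\<forall>e\<in>edges S. card {v \<in> verts S. v \<in> e} = 2"
      using assms by (auto simp: signed_graph_def Collect_conj_eq Int_absorb1)
  qed (use assms finite_edges[OF assms] in \<open>auto simp: signed_graph_def\<close>)
  then show ?thesis by (simp add: vdegree_def)
qed

lemma avg_degree_regular:
  assumes "signed_graph S" "verts S \<noteq> {}" "\<And>v. v \<in> verts S \<Longrightarrow> real (vdegree S v) = d"
  shows "avg_degree S = d"
proof -
  have "2 * real (card (edges S)) = (\<Sum>v\<in>verts S. real (vdegree S v))"
    using arg_cong[OF handshake[OF assms(1)], of real] by simp
  also have "\<dots> = real (card (verts S)) * d" using assms(3) by simp
  finally show ?thesis
    using assms(1,2) by (simp add: avg_degree_def signed_graph_def card_eq_0_iff)
qed

text \<open>An edge meets \<open>k - 1\<close> further edges at each of its ends, and no other edge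
  contains both ends.\<close>

lemma vdegree_line_graph:
  assumes S: "signed_graph S" and k: "regular S k" and e: "e \<in> edges S"
  shows "real (vdegree (line_graph S \<eta>) e) = 2 * real k - 2"
proof -
  obtain u v where uv: "e = {u, v}" "u \<noteq> v" "u \<in> verts S" "v \<in> verts S"
    using edge_doubleton[OF S e] .
  let ?E = "\<lambda>w. {f \<in> edges S. w \<in> f}"
  have fin: "finite (?E w)" for w using finite_edges[OF S] by simp
  have deg: "real (card (?E w - {e})) = real k - 1" if "w = u \<or> w = v" for w
  proof -
    have ew: "e \<in> ?E w" using e uv(1) that by auto
    have "card (?E w) = k" using k uv that by (auto simp: regular_def vdegree_def)
    moreover have "0 < card (?E w)" using ew fin by (auto simp: card_gt_0_iff)
    ultimately show ?thesis using ew by (simp add: card_Diff_singleton of_nat_diff)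
  qed
  have "f = e" if f: "f \<in> edges S" "u \<in> f" "v \<in> f" for f
  proof -
    obtain a b where "f = {a, b}" using edge_doubleton[OF S f(1)] .
    then show ?thesis using f(2,3) uv(1,2) by auto
  qed
  then have disj: "(?E u - {e}) \<inter> (?E v - {e}) = {}" by blast
  have "{p \<in> edges (line_graph S \<eta>). e \<in> p} = (\<lambda>f. {e, f}) ` ((?E u - {e}) \<union> (?E v - {e}))"
    (is "?L = ?R")
  proof
    show "?L \<subseteq> ?R"
    proof
      fix p assume p: "p \<in> ?L"
      then obtain g h where gh: "p = {g, h}" by (simp add: line_graph_def) blast
      \<comment> \<open>\<open>f\<close> is the member of \<open>p\<close> other than
        \<open>e\<close>.\<close>
      define f where "f = (if e = g then h else g)"
      have f: "p = {e, f}" using p unfolding gh f_def by auto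
      then have "f \<in> edges S \<and> e \<noteq> f \<and> e \<inter> f \<noteq> {}"
        using p line_graph_edge_iff[of e f S \<eta>] by simp
      then show "p \<in> ?R" unfolding f uv(1) by (intro imageI) auto
    qed
    show "?R \<subseteq> ?L"
      using e uv(1) by (auto simp: line_graph_edge_iff)
  qed
  then have "vdegree (line_graph S \<eta>) e = card ((\<lambda>f. {e, f}) ` ((?E u - {e}) \<union> (?E v - {e})))"
    by (simp add: vdegree_def)
  also have "\<dots> = card ((?E u - {e}) \<union> (?E v - {e}))"
    by (intro card_image inj_onI) (auto simp: doubleton_eq_iff)
  also have "\<dots> = card (?E u - {e}) + card (?E v - {e})"
    using fin disj by (intro card_Un_disjoint) auto
  finally show ?thesis using deg[of u] deg[of v] by simp
qed

lemma laplacian_mat_line_graph: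
  assumes S: "signed_graph S" and k: "regular S k" and es: "set es = edges S"
  shows "laplacian_mat (line_graph S \<eta>) es
    = (2 * real k - 2) \<cdot>\<^sub>m 1\<^sub>m (length es) - adjacency_mat (line_graph S \<eta>) es"
proof -
  have "es ! i \<in> edges S" if "i < length es" for i
    unfolding es[symmetric] using that by simp
  then have "deg_mat (line_graph S \<eta>) es = (2 * real k - 2) \<cdot>\<^sub>m 1\<^sub>m (length es)"
    using vdegree_line_graph[OF S k] by (intro eq_matI) (auto simp: deg_mat_def)
  then show ?thesis by (simp add: laplacian_mat_def)
qed

subsection \<open>Spectrum and energy of the line graph\<close>

text \<open>With its counterpart for upward closed sets, this turns the ordering of
  \<open>lam\<close> into exact positions: an initial segment of indices for \<open>- real k\<close>
  and a final one for \<open>real k\<close>, with the multiplicities as lengths.\<close>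

lemma down_closed_eq_interval:
  fixes A :: "nat set"
  assumes "A \<subseteq> {1..n}" "\<And>i j. j \<in> A \<Longrightarrow> 1 \<le> i \<Longrightarrow> i \<le> j \<Longrightarrow> i \<in> A"
  shows "A = {1..card A}"
proof (cases "A = {}")
  case False
  have fin: "finite A" using assms(1) finite_subset by blast
  have "A = {1..Max A}"
  proof
    show "A \<subseteq> {1..Max A}" using assms(1) fin by (auto simp: subset_iff)
    show "{1..Max A} \<subseteq> A" using assms(2)[OF Max_in[OF fin False]] by auto
  qed
  then show ?thesis by (metis card_atLeastAtMost diff_Suc_1 Suc_eq_plus1)
qed simp

text \<open>The complement in \<open>{1..n}\<close> is downward closed.\<close>

lemma up_closed_eq_interval:
  fixes A :: "nat set"
  assumes "A \<subseteq> {1..n}" "\<And>i j. i \<in> A \<Longrightarrow> i \<le> j \<Longrightarrow> j \<le> n \<Longrightarrow> j \<in> A"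
  shows "A = {n - card A + 1..n}"
proof -
  have "{1..n} - A = {1..card ({1..n} - A)}"
  proof (rule down_closed_eq_interval)
    fix i j assume "j \<in> {1..n} - A" "1 \<le> i" "i \<le> j"
    then show "i \<in> {1..n} - A" using assms(2)[of i j] by auto
  qed blast
  moreover have "card ({1..n} - A) = n - card A"
    using assms(1) by (simp add: card_Diff_subset finite_subset)
  ultimately have "{1..n} - A = {1..n - card A}" by simp
  then have "A = {1..n} - {1..n - card A}" using assms(1) by blast
  also have "\<dots> = {n - card A + 1..n}" by auto
  finally show ?thesis .
qed

lemma count_image_mset_set:
  "finite A \<Longrightarrow> count (image_mset f (mset_set A)) y = card {x \<in> A. f x = y}"
proof (induction A rule: finite_induct)
  case (insert x A)
  have "{a \<in> insert x A. f a = y}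
      = (if f x = y then insert x {a \<in> A. f a = y} else {a \<in> A. f a = y})"
    by auto
  then show ?case using insert by simp
qed simp

theorem theorem3p10:
  fixes S :: "'v signed_graph" and n m k :: nat
    and vs :: "'v list" and es :: "'v set list"
    and \<eta> :: "'v \<Rightarrow> 'v set \<Rightarrow> real" and lam :: "nat \<Rightarrow> real"
  assumes "signed_graph S" and "card (verts S) = n" and "card (edges S) = m"
    and "regular S k"
    and "set vs = verts S" and "distinct vs"
    and "set es = edges S" and "distinct es"
    and "incidence S \<eta>"
    (* lam 1, ..., lam n are the eigenvalues of S, with any equal to -k listed first
       and any equal to k listed last *)
    and "eigenvals (adjacency_mat S vs) = {# lam i. i \<in># mset_set {1..n} #}"
    and "\<forall>i\<in>{1..n}. \<forall>j\<in>{1..n}. i \<le> j \<longrightarrow>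
           (lam j = - real k \<longrightarrow> lam i = - real k) \<and> (lam i = real k \<longrightarrow> lam j = real k)"
  shows
    (* eigenvalues of S; the subtraction m + num_balanced S - n does not truncate;
       eigenvalues, Laplacian eigenvalues and energies of the line graph *)
    "(num_balanced (negation S) \<le> n \<and> num_balanced S \<le> n \<and>
      (\<forall>i\<in>{1..num_balanced (negation S)}. lam i = - real k) \<and>
      (\<forall>i\<in>{num_balanced (negation S) + 1..n - num_balanced S}.
         - real k < lam i \<and> lam i < real k) \<and>
      (\<forall>i\<in>{n - num_balanced S + 1..n}. lam i = real k)) \<and>
     n \<le> m + num_balanced S \<and>
     (eigenvals (adjacency_mat (line_graph S \<eta>) es) =
        {# lam i - real k + 2. i \<in># mset_set {1..n - num_balanced S} #}
        + replicate_mset (m + num_balanced S - n) 2 \<and>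
      (\<forall>i\<in>{1..num_balanced (negation S)}. lam i - real k + 2 = - (2 * real k - 2)) \<and>
      (\<forall>i\<in>{num_balanced (negation S) + 1..n - num_balanced S}.
         - (2 * real k - 2) < lam i - real k + 2 \<and> lam i - real k + 2 < 2)) \<and>
     (eigenvals (laplacian_mat (line_graph S \<eta>) es) =
        {# 3 * real k - 4 - lam i. i \<in># mset_set {1..n - num_balanced S} #}
        + replicate_mset (m + num_balanced S - n) (2 * real k - 4) \<and>
      (\<forall>i\<in>{1..num_balanced (negation S)}. 3 * real k - 4 - lam i = 4 * real k - 4) \<and>
      (\<forall>i\<in>{num_balanced (negation S) + 1..n - num_balanced S}.
         4 * real k - 4 > 3 * real k - 4 - lam i \<and> 3 * real k - 4 - lam i > 2 * real k - 4)) \<and>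
     energy (line_graph S \<eta>) es = laplacian_energy (line_graph S \<eta>) es \<and>
     laplacian_energy (line_graph S \<eta>) es =
       (\<Sum>i=1..n - num_balanced S. \<bar>lam i - (real k - 2)\<bar>)
       + 2 * (real m - real n + real (num_balanced S))"
proof -
  note S = assms(1) and k = assms(4) and vs = assms(5,6) and es = assms(7,8) and H = assms(9)
    and R = assms(10) and order = assms(11)
  define b where "b = num_balanced S"
  define c where "c = num_balanced (negation S)"
  define \<Lambda> where "\<Lambda> = line_graph S \<eta>"
  have len: "length vs = n" "length es = m"
    using distinct_card[OF vs(2)] distinct_card[OF es(2)] vs(1) es(1) assms(2,3) by simp_all
  have sizeR: "size {#lam i. i \<in># mset_set {1..n}#} = length vs" using len by simp
  note spec = spectrum_regular[OF S k vs R sizeR]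

  \<comment> \<open>Multiplicities are the sizes of the index sets \<open>?I a\<close>; the ordering
    hypothesis determines where the two extreme sets lie.\<close>
  let ?I = "\<lambda>a. {i \<in> {1..n}. lam i = a}"
  have cards: "card (?I (real k)) = b" "card (?I (- real k)) = c"
    using spec(1,2) by (simp_all add: count_image_mset_set b_def c_def)
  have low: "?I (- real k) = {1..c}"
    unfolding cards(2)[symmetric]
  proof (rule down_closed_eq_interval)
    fix i j assume "j \<in> ?I (- real k)" "1 \<le> i" "i \<le> j"
    then show "i \<in> ?I (- real k)" using order[rule_format, of i j] by simp
  qed blast
  have high: "?I (real k) = {n - b + 1..n}"
    unfolding cards(1)[symmetric]
  proof (rule up_closed_eq_interval)
    fix i j assume "i \<in> ?I (real k)" "i \<le> j" "j \<le> n"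
    then show "j \<in> ?I (real k)" using order[rule_format, of i j] by simp
  qed blast
  have le: "b \<le> n" "c \<le> n"
  proof -
    have "card (?I a) \<le> card {1..n}" for a by (rule card_mono) auto
    from this[of "real k"] this[of "- real k"] show "b \<le> n" "c \<le> n"
      unfolding cards by simp_all
  qed
  have lam_low: "lam i = - real k" if "i \<in> {1..c}" for i
    using that unfolding low[symmetric] by simp
  have lam_high: "lam i = real k" if "i \<in> {n - b + 1..n}" for i
    using that unfolding high[symmetric] by simp
  have range: "- real k \<le> lam i \<and> lam i \<le> real k" if "i \<in> {1..n}" for i
    using spec(3)[of "lam i"] that by simp
  have ne: "lam i \<noteq> real k" if "i \<in> {1..n - b}" for i
  proof
    assume "lam i = real k"
    then have "i \<in> {n - b + 1..n}" unfolding high[symmetric] using that by auto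
    then show False using that by auto
  qed
  have lam_mid: "- real k < lam i \<and> lam i < real k" if i: "i \<in> {c + 1..n - b}" for i
  proof -
    have "lam i \<noteq> - real k"
    proof
      assume "lam i = - real k"
      then have "i \<in> {1..c}" unfolding low[symmetric] using i by auto
      then show False using i by auto
    qed
    moreover have "lam i \<noteq> real k" using ne i by simp
    ultimately show ?thesis using range[of i] i by fastforce
  qed

  define B where "B = incidence_mat \<eta> vs es"
  have B: "B \<in> carrier_mat n m"
    unfolding B_def len[symmetric] by (rule incidence_mat_carrier)
  \<comment> \<open>\<open>Q\<close> is the spectrum of \<open>k I - A\<close> without its zeros;
    these come from the last \<open>b\<close> indices.\<close>
  define Q where "Q = {#real k - lam i. i \<in># mset_set {1..n - b}#}"
  have "{1..n} = {1..n - b} \<union> {n - b + 1..n}" by auto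
  then have "mset_set {1..n} = mset_set {1..n - b} + mset_set {n - b + 1..n}"
    by (simp add: mset_set_Union)
  moreover have "{#real k - lam i. i \<in># mset_set {n - b + 1..n}#} = replicate_mset b 0"
  proof -
    have "{#real k - lam i. i \<in># mset_set {n - b + 1..n}#}
        = {#0. i \<in># mset_set {n - b + 1..n}#}"
      using lam_high by (intro image_mset_cong) simp
    then show ?thesis using le by (simp add: image_mset_const_eq)
  qed
  ultimately have Qb: "{#real k - lam i. i \<in># mset_set {1..n}#} = Q + replicate_mset b 0"
    by (simp add: Q_def)
  have gram: "eigenvals (B * transpose_mat B) = Q + replicate_mset b 0"
    using eigenvals_scalar_minus[OF adjacency_mat_carrier R sizeR, of "real k"]
    unfolding B_def incidence_mat_mult_transpose[OF S H k vs es] Qb[symmetric]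
    by (simp add: multiset.map_comp comp_def)
  have "real k - lam i \<noteq> 0" if "i \<in> {1..n - b}" for i using ne[OF that] by simp
  then have "0 \<notin># Q" "size Q + b = n" using le by (force simp: Q_def)+
  \<comment> \<open>The other Gram matrix has the spectrum \<open>Q\<close> together with
    \<open>m + b - n\<close> zeros.\<close>
  note T = eigenvals_mult_transpose[OF B gram this(2,1)]
  have BB: "transpose_mat B * B \<in> carrier_mat m m" using B by simp

  \<comment> \<open>Subtracting from 2 sends \<open>real k - lam i\<close> to
    \<open>lam i - real k + 2\<close> and each zero to 2.\<close>
  have adj: "eigenvals (adjacency_mat \<Lambda> es)
      = {#lam i - real k + 2. i \<in># mset_set {1..n - b}#} + replicate_mset (m + b - n) 2"
    using eigenvals_scalar_minus[OF BB T(2), of 2] T(3)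
    unfolding \<Lambda>_def adjacency_mat_line_graph[OF S H vs es] B_def len
    by (simp add: Q_def multiset.map_comp comp_def algebra_simps)
  \<comment> \<open>The line graph has constant degree \<open>2 * real k - 2\<close>, from which its
    adjacency eigenvalues are subtracted.\<close>
  have lap: "eigenvals (laplacian_mat \<Lambda> es)
      = {#3 * real k - 4 - lam i. i \<in># mset_set {1..n - b}#}
        + replicate_mset (m + b - n) (2 * real k - 4)"
    using eigenvals_scalar_minus[OF adjacency_mat_carrier adj, of "2 * real k - 2"] T(3)
    unfolding \<Lambda>_def laplacian_mat_line_graph[OF S k es(1)] len
    by (simp add: Q_def multiset.map_comp comp_def algebra_simps)

  let ?sum = "(\<Sum>i=1..n - b. \<bar>lam i - (real k - 2)\<bar>) + 2 * (real m - real n + real b)"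
  have E: "energy \<Lambda> es = ?sum"
    unfolding energy_def adj using T(1)
    by (simp add: sum_unfold_sum_mset multiset.map_comp comp_def algebra_simps of_nat_diff)
  have EL: "laplacian_energy \<Lambda> es = ?sum"
  proof (cases "edges S = {}")
    \<comment> \<open>Here the line graph has no vertices, and its average degree is a division by
      zero. Both spectra are empty and \<open>n = b\<close>, so each side is 0.\<close>
    case True
    then have "m = 0" using assms(3) by simp
    then have "n - b = 0" "m + b - n = 0" using T(3) by (simp_all add: Q_def)
    then show ?thesis
      unfolding laplacian_energy_def lap using T(1) \<open>m = 0\<close> by simp
  next
    case False
    have avg: "avg_degree \<Lambda> = 2 * real k - 2"
      unfolding \<Lambda>_def using False vdegree_line_graph[OF S k]
      by (intro avg_degree_regular[OF signed_graph_line_graph[OF S H]])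
        (auto simp: line_graph_def)
    \<comment> \<open>Since the average degree is the common degree, the deviations are the negated
      adjacency eigenvalues of the line graph, which explains the equality of the two
      energies.\<close>
    have "laplacian_energy \<Lambda> es
        = (\<Sum>i=1..n - b. \<bar>- (lam i - (real k - 2))\<bar>) + real (m + b - n) * \<bar>-2\<bar>"
      unfolding laplacian_energy_def lap avg
      by (simp add: sum_unfold_sum_mset multiset.map_comp comp_def algebra_simps)
    then show ?thesis unfolding abs_minus_cancel using T(1) by (simp add: of_nat_diff)
  qed

  have line_low: "lam i - real k + 2 = - (2 * real k - 2)" "3 * real k - 4 - lam i = 4 * real k - 4"
    if "i \<in> {1..c}" for i
    using lam_low[OF that] by simp_all
  have line_mid: "- (2 * real k - 2) < lam i - real k + 2" "lam i - real k + 2 < 2"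
    "4 * real k - 4 > 3 * real k - 4 - lam i" "3 * real k - 4 - lam i > 2 * real k - 4"
    if "i \<in> {c + 1..n - b}" for i
    using lam_mid[OF that] by simp_all
  show ?thesis
    unfolding b_def[symmetric] c_def[symmetric] \<Lambda>_def[symmetric]
    using le T(1) adj lap lam_low lam_high lam_mid line_low line_mid
    by (simp add: E EL del: atLeastAtMost_iff)
qed

end
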